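(* Let $d\ge1$, $0\le s<d$, let $g$ be $(s,\phi)$-admissible, and let $\mu\in L^1(\mathbb{R}^d)\cap L^p(\mathbb{R}^d)$ for some $\frac d{d-s}<p\le\infty$ with $\int_{\mathbb{R}^d}\mu=1$. Suppose further that $\int_{(\mathbb{R}^d)^2}g(x-y)\,d\mu^{\otimes2}(x,y)<\infty$, and $\int_{(\mathbb{R}^d)^2}|g|(x-y)\,d|\mu|^{\otimes2}(x,y)<\infty$ if $s=0$. Let $X_N=(x_1,\dots,x_N)\in(\mathbb{R}^d)^N$ be a pairwise distinct configuration. Then for every $\eta>0$, $$\frac1{2N^2}\sum_{1\le i\ne j\le N}f_\eta(x_i-x_j)+\frac12\int_{(\mathbb{R}^d)^2}f_\eta(x-y)\,d\mu^{\otimes2}(x,y)+\frac12\int_{(\mathbb{R}^d)^2}g_\eta(x-y)\,d\Big(\frac1N\sum_{i=1}^N\delta_{x_i}-\mu\Big)^{\otimes2}(x,y)$$ $$\le F_N(X_N,\mu)+\frac{g_{\mathrm{Riesz}}(\eta)+C+C_\rho}{2N}\mathbf 1_{s=0}+CC_\zeta\frac{g_{\mathrm{Riesz}}(\eta)}{2N}\mathbf 1_{s>0}+CC_\zeta\|\mu\|_{L^p}\eta^{\frac{d(p-1)}p-s},$$ where $C=C(d,s,p,\phi)>0$, and $C_\rho\ge0$ depends only on $\rho$ and $d$, with $C_\rho=0$ when $\rho=0$.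
   Context: $\langle x\rangle=(1+|x|^2)^{1/2}$; $\hat f(\xi)=\int f(x)e^{-2\pi i\xi\cdot x}dx$. $g_{\mathrm{Riesz}}(x)=\frac1s|x|^{-s}$ if $s\ne0$, $-\log|x|$ if $s=0$ (evaluated at a positive number via $|x|$). For $p=\infty$, $\frac{p-1}p=1$. $F_N(X_N,\mu):=\frac12\int_{(\mathbb{R}^d)^2\setminus\triangle}g(x-y)\,d(\frac1N\sum_i\delta_{x_i}-\mu)^{\otimes2}(x,y)$, $\triangle$ the diagonal. **Admissibility.** $\phi:\mathbb{R}^d\to[0,\infty)$ is a bounded continuous, integrable, radial function (write $\phi(r)$), decreasing in $r$, $\phi(r)\to0$ as $r\to\infty$, not identically zero, $\hat\phi\ge0$, $\phi\in C^1(\mathbb{R}^d\setminus\{0\})$, such that: $\int_0^\infty r^{s-1}\phi(r)dr<\infty$ if $s>0$; $\int_0^\infty|\log(r)\phi'(r)|dr<\infty$ and $\lim_{r\to0^+}(\phi(r)-\phi(0))\log r=\lim_{r\to\infty}\phi(r)\log r=0$ if $s=0$; $\phi(x)\le C_\gamma\langle x\rangle^{-\gamma}$ for some $\gamma>s$; and $|x||\nabla\phi(x)|\le C\phi(cx)$ for some $c,C>0$. Let $\phi_t(x)=t^{-d}\phi(x/t)$, $\mathsf c_{\phi,d,s}^{-1}=s\int_0^\infty r^{s-1}\phi(r)dr$ if $s>0$, $\mathsf c_{\phi,d,0}^{-1}=\phi(0)$, $C_{\phi,T}=\phi(0)\log T-\int_0^\infty\log(r)\phi'(r)dr$. A potential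 $g:\mathbb{R}^d\setminus\{0\}\to\mathbb{R}$ is $(s,\phi)$-admissible if $g(x)=\lim_{T\to\infty}\mathsf c_{\phi,d,s}\big(\int_0^T\zeta(t)\phi_t(x)\frac{dt}t-C_{\phi,T}\mathbf 1_{s=0}\big)$ for all $x\ne0$, where $\zeta:(0,\infty)\to[0,\infty)$ is locally integrable, $C_\zeta^{-1}t^{d-s}\le\zeta(t)\le C_\zeta t^{d-s}$ for all $t>0$ and some $C_\zeta>0$, and, if $s=0$, $\zeta(t)=t^d+\rho(t)$ with $\rho\ge0$ locally integrable on $(0,\infty)$ and $\int_0^\infty\rho(t)t^{-d}\frac{dt}t<\infty$. In the case $s=0$, one takes $C_\zeta=1$ in estimates. **Truncation.** For $\eta>0$, $g_\eta(x):=\mathsf c_{\phi,d,s}\int_\eta^\infty\zeta(t)\phi_t(x)\frac{dt}t$ if $s>0$, and $g_\eta(x):=\mathsf c_{\phi,d,0}\lim_{T\to\infty}\big(\int_\eta^Tt^d\phi_t(x)\frac{dt}t+\int_0^\infty\rho(t)\phi_t(x)\frac{dt}t-C_{\phi,T}\big)$ if $s=0$; $f_\eta:=g-g_\eta$. *)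

theory Defs
  imports "HOL-Analysis.Analysis" "HOL-Probability.Essential_Supremum"
begin

text \<open>
  The space is a Euclidean space \<open>'a\<close> of dimension \<open>d = DIM('a)\<close>.  The measure \<open>\<mu>\<close> is identified
  with its (signed) Borel density with respect to Lebesgue measure.
\<close>

text \<open>Exponents range over \<open>[1, \<infinity>]\<close>; the definitions are not meaningful for other values of \<open>p\<close>.\<close>

definition in_Lp :: "ereal \<Rightarrow> ('a::euclidean_space \<Rightarrow> real) \<Rightarrow> bool" where
  "in_Lp p f \<longleftrightarrow> f \<in> borel_measurable lborel \<and>
     (if p = \<infinity> then (\<exists>B. AE x in lborel. \<bar>f x\<bar> \<le> B)
      else integrable lborel (\<lambda>x. \<bar>f x\<bar> powr real_of_ereal p))"

definition Lp_norm :: "ereal \<Rightarrow> ('a::euclidean_space \<Rightarrow> real) \<Rightarrow> real" where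
  "Lp_norm p f =
     (if p = \<infinity> then real_of_ereal (esssup lborel (\<lambda>x. ereal \<bar>f x\<bar>))
      else (LINT x|lborel. \<bar>f x\<bar> powr real_of_ereal p) powr (1 / real_of_ereal p))"

definition inv_conj_exponent :: "ereal \<Rightarrow> real" where
  "inv_conj_exponent p = (if p = \<infinity> then 1 else (real_of_ereal p - 1) / real_of_ereal p)"

definition japanese :: "'a::euclidean_space \<Rightarrow> real" where
  "japanese x = sqrt (1 + (norm x)\<^sup>2)"

definition fourier :: "('a::euclidean_space \<Rightarrow> real) \<Rightarrow> 'a \<Rightarrow> complex" where
  "fourier f \<xi> = (LINT x|lborel. complex_of_real (f x) * exp (- (2 * pi * \<i> * complex_of_real (\<xi> \<bullet> x))))"

definition g_Riesz :: "real \<Rightarrow> 'a::real_normed_vector \<Rightarrow> real" where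
  "g_Riesz s x = (if s = 0 then - ln (norm x) else norm x powr (- s) / s)"

definition radial :: "('a::euclidean_space \<Rightarrow> real) \<Rightarrow> bool" where
  "radial \<phi> \<longleftrightarrow> (\<forall>x y. norm x = norm y \<longrightarrow> \<phi> x = \<phi> y)"

text \<open>For radial \<open>\<phi>\<close> and \<open>r \<ge> 0\<close> this is the value \<open>\<phi>(r)\<close>; the choice of the unit vector is immaterial.\<close>

definition profile :: "('a::euclidean_space \<Rightarrow> real) \<Rightarrow> real \<Rightarrow> real" where
  "profile \<phi> r = \<phi> (r *\<^sub>R (SOME b. b \<in> Basis))"

definition admissible_profile :: "real \<Rightarrow> ('a::euclidean_space \<Rightarrow> real) \<Rightarrow> bool" where
  "admissible_profile s \<phi> \<longleftrightarrow>
     (\<forall>x. 0 \<le> \<phi> x) \<and> bounded (range \<phi>) \<and> continuous_on UNIV \<phi> \<and> integrable lborel \<phi> \<and>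
     radial \<phi> \<and> antimono_on {0..} (profile \<phi>) \<and> (profile \<phi> \<longlongrightarrow> 0) at_top \<and>
     (\<exists>x. \<phi> x \<noteq> 0) \<and>
     (\<forall>\<xi>. fourier \<phi> \<xi> \<in> \<real>\<^sub>\<ge>\<^sub>0) \<and>
     (s > 0 \<longrightarrow> set_integrable lborel {0<..} (\<lambda>r. r powr (s - 1) * profile \<phi> r)) \<and>
     (s = 0 \<longrightarrow>
        set_integrable lborel {0<..} (\<lambda>r. ln r * deriv (profile \<phi>) r) \<and>
        ((\<lambda>r. (profile \<phi> r - profile \<phi> 0) * ln r) \<longlongrightarrow> 0) (at_right 0) \<and>
        ((\<lambda>r. profile \<phi> r * ln r) \<longlongrightarrow> 0) at_top) \<and>
     (\<exists>\<gamma>>s. \<exists>C. \<forall>x. \<phi> x \<le> C * japanese x powr (- \<gamma>)) \<and>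
     (\<exists>G. continuous_on (- {0}) G \<and> (\<forall>x. x \<noteq> 0 \<longrightarrow> GDERIV \<phi> x :> G x) \<and>
        (\<exists>c>0. \<exists>C>0. \<forall>x. x \<noteq> 0 \<longrightarrow> norm x * norm (G x) \<le> C * \<phi> (c *\<^sub>R x)))"

definition scaled :: "('a::euclidean_space \<Rightarrow> real) \<Rightarrow> real \<Rightarrow> 'a \<Rightarrow> real" where  \<comment> \<open>\<open>\<phi>\<^sub>t(x)\<close>\<close>
  "scaled \<phi> t x = \<phi> (x /\<^sub>R t) / t ^ DIM('a)"

definition c_const :: "real \<Rightarrow> ('a::euclidean_space \<Rightarrow> real) \<Rightarrow> real" where
  "c_const s \<phi> = inverse (if s = 0 then profile \<phi> 0
     else s * (LINT r:{0<..}|lborel. r powr (s - 1) * profile \<phi> r))"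

definition C_log :: "('a::euclidean_space \<Rightarrow> real) \<Rightarrow> real \<Rightarrow> real" where  \<comment> \<open>\<open>C\<^bsub>\<phi>,T\<^esub>\<close>\<close>
  "C_log \<phi> T = profile \<phi> 0 * ln T - (LINT r:{0<..}|lborel. ln r * deriv (profile \<phi>) r)"

definition locally_integrable_pos :: "(real \<Rightarrow> real) \<Rightarrow> bool" where
  "locally_integrable_pos f \<longleftrightarrow> (\<forall>a b. 0 < a \<and> a \<le> b \<longrightarrow> set_integrable lborel {a..b} f)"

text \<open>
  \<open>g\<close> is \<open>(s, \<phi>)\<close>-admissible, with the data \<open>C\<^sub>\<zeta>\<close>, \<open>\<zeta>\<close> and \<open>\<rho>\<close> displayed because the estimates depend
  on them.  Only the values of \<open>\<zeta>\<close> and \<open>\<rho>\<close> on \<open>(0, \<infinity>)\<close> and of \<open>g\<close> off the origin matter, and \<open>\<rho>\<close> is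
  unconstrained if \<open>s \<noteq> 0\<close>.
\<close>

definition admissible_potential ::
  "real \<Rightarrow> ('a::euclidean_space \<Rightarrow> real) \<Rightarrow> real \<Rightarrow> (real \<Rightarrow> real) \<Rightarrow> (real \<Rightarrow> real) \<Rightarrow> ('a \<Rightarrow> real) \<Rightarrow> bool" where
  "admissible_potential s \<phi> C\<^sub>\<zeta> \<zeta> \<rho> g \<longleftrightarrow>
     locally_integrable_pos \<zeta> \<and> (\<forall>t>0. 0 \<le> \<zeta> t) \<and>
     C\<^sub>\<zeta> > 0 \<and>
     (\<forall>t>0. inverse C\<^sub>\<zeta> * t powr (real DIM('a) - s) \<le> \<zeta> t \<and> \<zeta> t \<le> C\<^sub>\<zeta> * t powr (real DIM('a) - s)) \<and>
     (s = 0 \<longrightarrow>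
        (\<forall>t>0. \<zeta> t = t ^ DIM('a) + \<rho> t \<and> 0 \<le> \<rho> t) \<and> locally_integrable_pos \<rho> \<and>
        set_integrable lborel {0<..} (\<lambda>t. \<rho> t / t ^ DIM('a) / t)) \<and>
     (\<forall>x. x \<noteq> 0 \<longrightarrow>
        ((\<lambda>T. c_const s \<phi> *
            ((LINT t:{0<..T}|lborel. \<zeta> t * scaled \<phi> t x / t) - (if s = 0 then C_log \<phi> T else 0)))
          \<longlongrightarrow> g x) at_top)"

definition g_trunc ::
  "real \<Rightarrow> ('a::euclidean_space \<Rightarrow> real) \<Rightarrow> (real \<Rightarrow> real) \<Rightarrow> (real \<Rightarrow> real) \<Rightarrow> real \<Rightarrow> 'a \<Rightarrow> real" where
  "g_trunc s \<phi> \<zeta> \<rho> \<eta> x =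
     (if s = 0 then
        c_const 0 \<phi> * Lim at_top (\<lambda>T.
          (LINT t:{\<eta>..T}|lborel. t ^ DIM('a) * scaled \<phi> t x / t)
          + (LINT t:{0<..}|lborel. \<rho> t * scaled \<phi> t x / t) - C_log \<phi> T)
      else c_const s \<phi> * (LINT t:{\<eta>..}|lborel. \<zeta> t * scaled \<phi> t x / t))"

definition f_trunc ::
  "real \<Rightarrow> ('a::euclidean_space \<Rightarrow> real) \<Rightarrow> (real \<Rightarrow> real) \<Rightarrow> (real \<Rightarrow> real) \<Rightarrow> ('a \<Rightarrow> real) \<Rightarrow> real \<Rightarrow> 'a \<Rightarrow> real" where
  "f_trunc s \<phi> \<zeta> \<rho> g \<eta> x = g x - g_trunc s \<phi> \<zeta> \<rho> \<eta> x"

definition empirical_measure :: "nat \<Rightarrow> (nat \<Rightarrow> 'a::euclidean_space) \<Rightarrow> 'a measure" where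
  "empirical_measure N X = distr (uniform_count_measure {1..N}) borel X"

text \<open>
  The integral of \<open>k\<close> over \<open>A\<close> against the tensor square of the signed measure \<open>P - \<mu>(x) dx\<close>, where
  \<open>P\<close> is a positive measure: the tensor square is
  \<open>P \<otimes> P - P \<otimes> \<mu> - \<mu> \<otimes> P + \<mu> \<otimes> \<mu>\<close>, and \<open>\<mu>\<close> enters the product measures as a density.
\<close>

definition diff_square_integral ::
  "'a::euclidean_space measure \<Rightarrow> ('a \<Rightarrow> real) \<Rightarrow> ('a \<times> 'a) set \<Rightarrow> ('a \<times> 'a \<Rightarrow> real) \<Rightarrow> real" where
  "diff_square_integral P \<mu> A k =
     (LINT z:A|(P \<Otimes>\<^sub>M P). k z)
     - (LINT z:A|(P \<Otimes>\<^sub>M lborel). k z * \<mu> (snd z))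
     - (LINT z:A|(lborel \<Otimes>\<^sub>M P). k z * \<mu> (fst z))
     + (LINT z:A|(lborel \<Otimes>\<^sub>M lborel). k z * (\<mu> (fst z) * \<mu> (snd z)))"

definition modulated_energy ::
  "('a::euclidean_space \<Rightarrow> real) \<Rightarrow> nat \<Rightarrow> (nat \<Rightarrow> 'a) \<Rightarrow> ('a \<Rightarrow> real) \<Rightarrow> real" where
  "modulated_energy g N X \<mu> =
     1 / 2 * diff_square_integral (empirical_measure N X) \<mu> (- {(x, y). x = y})
       (\<lambda>(x, y). g (x - y))"

end

theory Submission
  imports Defs "HOL-Probability.Probability_Measure"
begin

text \<open>
  Off the origin \<open>g = f\<^sub>\<eta> + g\<^sub>\<eta>\<close>.  Insert this into the three tensor squares of
  \<open>\<mu>\<^sub>N - \<mu>\<close>, where \<open>\<mu>\<^sub>N\<close> is the empirical measure.  Almost everything recombines, and the left-hand side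
  minus the modulated energy is exactly
  \<open>g\<^sub>\<eta>(0) / (2N) + (1/N) \<Sum>\<^sub>i \<integral> f\<^sub>\<eta>(x\<^sub>i - y) \<mu>(y) dy\<close> whenever the integrals converge: the first term is the diagonal
  \<open>i = j\<close>, which the modulated energy omits; the second comes from the two mixed terms
  (\<open>energy_splitting\<close>).  It remains to bound these two terms.

  The truncated part \<open>f\<^sub>\<eta>\<close> is the superposition of the \<open>\<phi>\<^sub>t\<close> over the scales \<open>t < \<eta>\<close>, with
  a weight of size \<open>t powr (d - s)\<close> (\<open>f_trunc_eq\<close>).  At each scale, Hoelder's inequality bounds the
  convolution of \<open>\<phi>\<^sub>t\<close> with \<open>\<bar>\<mu>\<bar>\<close> by the \<open>L\<^sup>p\<close> norm of \<open>\<mu>\<close> times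
  \<open>t powr (\<kappa> - d)\<close>, where \<open>\<kappa> = d * (p - 1) / p\<close> (\<open>convolution_profile_le_Lp_norm\<close>).  Integrating over the
  scales leaves \<open>\<integral> t powr (\<kappa> - s - 1) dt\<close> over \<open>(0, \<eta>)\<close>, a multiple of \<open>\<eta> powr (\<kappa> - s)\<close>; convergence
  at \<open>0\<close> is the assumption \<open>p > d / (d - s)\<close> (\<open>short_range_potential_bound\<close>).

  The self-interaction \<open>g\<^sub>\<eta>(0)\<close> is, for \<open>s > 0\<close>, an integral over the scales above \<open>\<eta>\<close> of a
  quantity of size \<open>t powr (- s - 1)\<close>, hence at most a multiple of \<open>g_Riesz s \<eta>\<close>
  (\<open>g_trunc_positive_bounds\<close>).  For \<open>s = 0\<close> the renormalised integral is explicit: \<open>- ln \<eta>\<close> plus a constant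
  of \<open>\<phi>\<close> plus \<open>\<integral> \<rho>(t) / t powr (d + 1) dt\<close>, and the last integral is the constant that depends only on
  \<open>\<rho>\<close> and \<open>d\<close> (\<open>g_trunc_origin_logarithmic\<close>).
\<close>

section \<open>Splitting the energy along a decomposition of the kernel\<close>

text \<open>
  This holds even if \<open>h\<close> is not integrable: then \<open>h + f\<close> is not integrable either, and both
  integrals take the default value \<open>0\<close>.  It allows the mixed point-background terms to be
  compared without knowing that they converge, which for \<open>s = 0\<close> depends on the logarithmic
  growth of the potential at infinity.
\<close>

lemma integral_add_diff_le_integral_abs:
  fixes f h :: "'b \<Rightarrow> real"
  assumes "integrable M f"
  shows "(LINT x|M. h x + f x) - (LINT x|M. h x) \<le> (LINT x|M. \<bar>f x\<bar>)"
proof (cases "integrable M h")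
  case True
  then have "(LINT x|M. h x + f x) - (LINT x|M. h x) = (LINT x|M. f x)"
    using assms by simp
  also have "\<dots> \<le> (LINT x|M. \<bar>f x\<bar>)"
    using assms by (intro integral_mono) auto
  finally show ?thesis .
next
  case False
  have "\<not> integrable M (\<lambda>x. h x + f x)"
  proof
    assume "integrable M (\<lambda>x. h x + f x)"
    from Bochner_Integration.integrable_diff[OF this assms] False show False by simp
  qed
  with False show ?thesis
    by (simp add: not_integrable_integral_eq)
qed

lemma prob_space_empirical_measure: "1 \<le> N \<Longrightarrow> prob_space (empirical_measure N X)"
  unfolding empirical_measure_def
  by (intro prob_space.prob_space_distr prob_space_uniform_count_measure) auto

lemma sets_empirical_measure [simp, measurable_cong]: "sets (empirical_measure N X) = sets borel"
  by (simp add: empirical_measure_def)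

lemma
  fixes h :: "'a::euclidean_space \<Rightarrow> real"
  assumes [measurable]: "h \<in> borel_measurable borel" and "1 \<le> N"
  shows integrable_empirical_measure: "integrable (empirical_measure N X) h"
    and integral_empirical_measure: "(LINT x|empirical_measure N X. h x) = (\<Sum>i\<in>{1..N}. h (X i)) / real N"
proof -
  have X [measurable]: "X \<in> uniform_count_measure {1..N} \<rightarrow>\<^sub>M borel" by simp
  show "integrable (empirical_measure N X) h"
    unfolding empirical_measure_def
    by (subst integrable_distr_eq)
      (auto simp: uniform_count_measure_def integrable_point_measure_finite)
  show "(LINT x|empirical_measure N X. h x) = (\<Sum>i\<in>{1..N}. h (X i)) / real N"
    unfolding empirical_measure_def
    by (subst integral_distr[OF X]) (simp_all add: integral_uniform_count_measure)
qed

lemma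
  fixes h :: "'a::euclidean_space \<times> 'a \<Rightarrow> real"
  assumes [measurable]: "h \<in> borel_measurable (borel \<Otimes>\<^sub>M borel)" and N: "1 \<le> N"
  shows integrable_empirical_square:
      "integrable (empirical_measure N X \<Otimes>\<^sub>M empirical_measure N X) h"
    and integral_empirical_square:
      "(LINT z|(empirical_measure N X \<Otimes>\<^sub>M empirical_measure N X). h z)
         = (\<Sum>i\<in>{1..N}. \<Sum>j\<in>{1..N}. h (X i, X j)) / (real N)\<^sup>2"
proof -
  let ?E = "empirical_measure N X"
  interpret E: prob_space ?E by (rule prob_space_empirical_measure[OF N])
  interpret EE: pair_sigma_finite ?E ?E ..
  show int: "integrable (?E \<Otimes>\<^sub>M ?E) h"
    by (rule EE.Fubini_integrable) (auto intro!: integrable_empirical_measure N)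
  have "(LINT z|(?E \<Otimes>\<^sub>M ?E). h z) = (LINT x|?E. LINT y|?E. h (x, y))"
    by (rule EE.integral_fst'[OF int, symmetric])
  also have "\<dots> = (LINT x|?E. (\<Sum>j\<in>{1..N}. h (x, X j)) / real N)"
    by (intro Bochner_Integration.integral_cong refl integral_empirical_measure N) measurable
  also have "\<dots> = (\<Sum>i\<in>{1..N}. \<Sum>j\<in>{1..N}. h (X i, X j)) / (real N)\<^sup>2"
    by (subst integral_empirical_measure[OF _ N])
      (auto simp: power2_eq_square sum_divide_distrib)
  finally show "(LINT z|(?E \<Otimes>\<^sub>M ?E). h z)
      = (\<Sum>i\<in>{1..N}. \<Sum>j\<in>{1..N}. h (X i, X j)) / (real N)\<^sup>2" .
qed

text \<open>
  Averaging over a probability measure does not increase a uniform bound on the sections.  With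
  the empirical measure as \<open>P\<close>, a bound on the potential of \<open>\<mu>\<close> at every point controls the mixed
  terms.
\<close>

lemma integrable_pair_section_bound:
  fixes h :: "'b \<times> 'c \<Rightarrow> real"
  assumes P: "prob_space P" and M: "sigma_finite_measure M"
    and h [measurable]: "h \<in> borel_measurable (P \<Otimes>\<^sub>M M)"
    and B: "0 \<le> B" "\<And>x. x \<in> space P \<Longrightarrow> (\<integral>\<^sup>+ y. ennreal \<bar>h (x, y)\<bar> \<partial>M) \<le> ennreal B"
  shows "integrable (P \<Otimes>\<^sub>M M) h \<and> (LINT z|(P \<Otimes>\<^sub>M M). \<bar>h z\<bar>) \<le> B"
proof -
  interpret P: prob_space P by fact
  interpret M: sigma_finite_measure M by fact
  have "(\<integral>\<^sup>+ z. ennreal \<bar>h z\<bar> \<partial>(P \<Otimes>\<^sub>M M)) = (\<integral>\<^sup>+ x. \<integral>\<^sup>+ y. ennreal \<bar>h (x, y)\<bar> \<partial>M \<partial>P)"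
    by (rule M.nn_integral_fst[symmetric]) measurable
  also have "\<dots> \<le> (\<integral>\<^sup>+ x. ennreal B \<partial>P)"
    by (rule nn_integral_mono) (rule B(2))
  also have "\<dots> = ennreal B"
    by (simp add: P.emeasure_space_1)
  finally have le: "(\<integral>\<^sup>+ z. ennreal \<bar>h z\<bar> \<partial>(P \<Otimes>\<^sub>M M)) \<le> ennreal B" .
  then have int: "integrable (P \<Otimes>\<^sub>M M) h"
    by (intro integrableI_bounded) (auto intro: le_less_trans)
  moreover have "(LINT z|(P \<Otimes>\<^sub>M M). \<bar>h z\<bar>) \<le> B"
  proof -
    have "ennreal (LINT z|(P \<Otimes>\<^sub>M M). \<bar>h z\<bar>) = (\<integral>\<^sup>+ z. ennreal \<bar>h z\<bar> \<partial>(P \<Otimes>\<^sub>M M))"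
      by (rule nn_integral_eq_integral[symmetric]) (use int in auto)
    with le have "ennreal (LINT z|(P \<Otimes>\<^sub>M M). \<bar>h z\<bar>) \<le> ennreal B" by simp
    with B(1) show ?thesis by (simp add: ennreal_le_iff)
  qed
  ultimately show ?thesis ..
qed

lemma AE_lborel_pair_neq: "AE z in lborel \<Otimes>\<^sub>M lborel. fst z \<noteq> (snd z :: 'a::euclidean_space)"
proof -
  have "AE y in lborel. x \<noteq> y" for x :: 'a
    using AE_lborel_singleton[of x] by eventually_elim auto
  moreover have "{z \<in> space (lborel \<Otimes>\<^sub>M lborel). fst z - snd z \<noteq> (0::'a)} \<in> sets (lborel \<Otimes>\<^sub>M lborel)"
    by measurable
  ultimately show ?thesis
    by (intro lborel_pair.AE_pair_measure) auto
qed

text \<open>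
  The algebraic core.  Expand the three tensor squares.  The point-point terms on the left exceed
  those of the modulated energy by the diagonal \<open>i = j\<close>, which is present only in the
  \<open>g\<^sub>\<eta>\<close> term and contributes \<open>g\<^sub>\<eta> 0 / N\<close>; the background-background terms agree; and each of the two
  mixed terms loses the potential of \<open>\<mu>\<close> for the kernel \<open>g - g\<^sub>\<eta>\<close>, averaged over the points,
  which is at most \<open>B\<close>.  There is one bound for each order of the arguments, that is, one for each
  mixed term.  As \<open>g - g\<^sub>\<eta>\<close> is integrable against \<open>\<mu> \<otimes> \<mu>\<close>, it is enough that one of
  \<open>g\<close> and \<open>g\<^sub>\<eta>\<close> is.
\<close>

lemma energy_splitting:
  fixes g g\<^sub>\<eta> \<mu> :: "'a::euclidean_space \<Rightarrow> real"
  assumes g [measurable]: "g \<in> borel_measurable borel"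
    and g\<eta> [measurable]: "g\<^sub>\<eta> \<in> borel_measurable borel"
    and \<mu>: "integrable lborel \<mu>"
    and N: "1 \<le> N" and X: "inj_on X {1..N}" and B: "0 \<le> B"
    and bound1: "\<And>x. (\<integral>\<^sup>+ y. ennreal (\<bar>g (x - y) - g\<^sub>\<eta> (x - y)\<bar> * \<bar>\<mu> y\<bar>) \<partial>lborel) \<le> ennreal B"
    and bound2: "\<And>y. (\<integral>\<^sup>+ x. ennreal (\<bar>g (x - y) - g\<^sub>\<eta> (x - y)\<bar> * \<bar>\<mu> x\<bar>) \<partial>lborel) \<le> ennreal B"
    and int: "integrable (lborel \<Otimes>\<^sub>M lborel) (\<lambda>(x, y). g\<^sub>\<eta> (x - y) * (\<mu> x * \<mu> y)) \<or>
      integrable (lborel \<Otimes>\<^sub>M lborel) (\<lambda>(x, y). g (x - y) * (\<mu> x * \<mu> y))"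
  shows "1 / (2 * (real N)\<^sup>2) * (\<Sum>i\<in>{1..N}. \<Sum>j\<in>{1..N} - {i}. g (X i - X j) - g\<^sub>\<eta> (X i - X j))
      + 1 / 2 * (LINT (x, y)|(lborel \<Otimes>\<^sub>M lborel). (g (x - y) - g\<^sub>\<eta> (x - y)) * (\<mu> x * \<mu> y))
      + 1 / 2 * diff_square_integral (empirical_measure N X) \<mu> UNIV (\<lambda>(x, y). g\<^sub>\<eta> (x - y))
    \<le> modulated_energy g N X \<mu> + g\<^sub>\<eta> 0 / (2 * real N) + B"
proof -
  let ?E = "empirical_measure N X"
  \<comment> \<open>Setting the kernel to \<open>0\<close> at the origin removes the diagonal pointwise, for every product measure
      at once, and turns the decomposition \<open>h = g\<^sub>\<eta> + f\<close> into an identity everywhere, with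
      \<open>f 0 = - g\<^sub>\<eta> 0\<close>.\<close>
  define h where "h x = (if x = 0 then 0 else g x)" for x
  define f where "f x = h x - g\<^sub>\<eta> x" for x
  have [measurable]: "\<mu> \<in> borel_measurable borel" using \<mu> by auto
  have h_meas [measurable]: "h \<in> borel_measurable borel" and [measurable]: "f \<in> borel_measurable borel"
    unfolding h_def f_def by measurable
  have h_eq: "h x = g\<^sub>\<eta> x + f x" for x by (simp add: f_def)
  interpret E: prob_space ?E by (rule prob_space_empirical_measure[OF N])
  interpret LE: pair_sigma_finite lborel ?E ..
  have sb1: "(\<integral>\<^sup>+ y. ennreal \<bar>f (x - y) * \<mu> y\<bar> \<partial>lborel) \<le> ennreal B" for x
  proof -
    have "(\<integral>\<^sup>+ y. ennreal \<bar>f (x - y) * \<mu> y\<bar> \<partial>lborel)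
        = (\<integral>\<^sup>+ y. ennreal (\<bar>g (x - y) - g\<^sub>\<eta> (x - y)\<bar> * \<bar>\<mu> y\<bar>) \<partial>lborel)"
      by (intro nn_integral_cong_AE eventually_mono[OF AE_lborel_singleton[of x]])
        (auto simp: f_def h_def abs_mult)
    with bound1[of x] show ?thesis by simp
  qed
  have sb2: "(\<integral>\<^sup>+ x. ennreal \<bar>f (x - y) * \<mu> x\<bar> \<partial>lborel) \<le> ennreal B" for y
  proof -
    have "(\<integral>\<^sup>+ x. ennreal \<bar>f (x - y) * \<mu> x\<bar> \<partial>lborel)
        = (\<integral>\<^sup>+ x. ennreal (\<bar>g (x - y) - g\<^sub>\<eta> (x - y)\<bar> * \<bar>\<mu> x\<bar>) \<partial>lborel)"
      by (intro nn_integral_cong_AE eventually_mono[OF AE_lborel_singleton[of y]])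
        (auto simp: f_def h_def abs_mult)
    with bound2[of y] show ?thesis by simp
  qed
  have T1: "1 / (real N)\<^sup>2 * (\<Sum>i\<in>{1..N}. \<Sum>j\<in>{1..N} - {i}. g (X i - X j) - g\<^sub>\<eta> (X i - X j))
      + (LINT z|(?E \<Otimes>\<^sub>M ?E). g\<^sub>\<eta> (fst z - snd z))
      = (LINT z|(?E \<Otimes>\<^sub>M ?E). h (fst z - snd z)) + g\<^sub>\<eta> 0 / real N"
  proof -
    have row: "(\<Sum>j\<in>{1..N}. h (X i - X j)) - (\<Sum>j\<in>{1..N}. g\<^sub>\<eta> (X i - X j))
        = (\<Sum>j\<in>{1..N} - {i}. g (X i - X j) - g\<^sub>\<eta> (X i - X j)) - g\<^sub>\<eta> 0" if i: "i \<in> {1..N}" for i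
    proof -
      have "(\<Sum>j\<in>{1..N}. h (X i - X j)) - (\<Sum>j\<in>{1..N}. g\<^sub>\<eta> (X i - X j)) = (\<Sum>j\<in>{1..N}. f (X i - X j))"
        by (simp add: f_def sum_subtractf)
      also have "\<dots> = f (X i - X i) + (\<Sum>j\<in>{1..N} - {i}. f (X i - X j))"
        using i by (simp add: sum.remove)
      also have "(\<Sum>j\<in>{1..N} - {i}. f (X i - X j)) = (\<Sum>j\<in>{1..N} - {i}. g (X i - X j) - g\<^sub>\<eta> (X i - X j))"
        using X i by (intro sum.cong refl) (auto simp: f_def h_def dest: inj_onD)
      finally show ?thesis by (simp add: f_def h_def)
    qed
    have "(LINT z|(?E \<Otimes>\<^sub>M ?E). h (fst z - snd z)) - (LINT z|(?E \<Otimes>\<^sub>M ?E). g\<^sub>\<eta> (fst z - snd z))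
        = ((\<Sum>i\<in>{1..N}. \<Sum>j\<in>{1..N}. h (X i - X j)) - (\<Sum>i\<in>{1..N}. \<Sum>j\<in>{1..N}. g\<^sub>\<eta> (X i - X j))) / (real N)\<^sup>2"
      using N by (simp add: integral_empirical_square diff_divide_distrib)
    also have "\<dots> = ((\<Sum>i\<in>{1..N}. \<Sum>j\<in>{1..N} - {i}. g (X i - X j) - g\<^sub>\<eta> (X i - X j)) - real N * g\<^sub>\<eta> 0) / (real N)\<^sup>2"
    proof -
      have "(\<Sum>i\<in>{1..N}. \<Sum>j\<in>{1..N}. h (X i - X j)) - (\<Sum>i\<in>{1..N}. \<Sum>j\<in>{1..N}. g\<^sub>\<eta> (X i - X j))
          = (\<Sum>i\<in>{1..N}. (\<Sum>j\<in>{1..N} - {i}. g (X i - X j) - g\<^sub>\<eta> (X i - X j)) - g\<^sub>\<eta> 0)"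
        by (subst sum_subtractf[symmetric]) (intro sum.cong refl row)
      then show ?thesis by (simp add: sum_subtractf)
    qed
    finally show ?thesis
      using N by (simp add: diff_divide_distrib power2_eq_square)
  qed
  have T2: "(LINT z|(?E \<Otimes>\<^sub>M lborel). h (fst z - snd z) * \<mu> (snd z))
      - (LINT z|(?E \<Otimes>\<^sub>M lborel). g\<^sub>\<eta> (fst z - snd z) * \<mu> (snd z)) \<le> B"
  proof -
    have *: "integrable (?E \<Otimes>\<^sub>M lborel) (\<lambda>z. f (fst z - snd z) * \<mu> (snd z)) \<and>
        (LINT z|(?E \<Otimes>\<^sub>M lborel). \<bar>f (fst z - snd z) * \<mu> (snd z)\<bar>) \<le> B"
      by (rule integrable_pair_section_bound)
        (use sb1 B E.prob_space_axioms lborel.sigma_finite_measure_axioms in auto)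
    show ?thesis
      using integral_add_diff_le_integral_abs[OF conjunct1[OF *],
          of "\<lambda>z. g\<^sub>\<eta> (fst z - snd z) * \<mu> (snd z)"] *
      by (simp add: h_eq ring_distribs)
  qed
  have T3: "(LINT z|(lborel \<Otimes>\<^sub>M ?E). h (fst z - snd z) * \<mu> (fst z))
      - (LINT z|(lborel \<Otimes>\<^sub>M ?E). g\<^sub>\<eta> (fst z - snd z) * \<mu> (fst z)) \<le> B"
  proof -
    have *: "integrable (?E \<Otimes>\<^sub>M lborel) (\<lambda>z. f (snd z - fst z) * \<mu> (snd z)) \<and>
        (LINT z|(?E \<Otimes>\<^sub>M lborel). \<bar>f (snd z - fst z) * \<mu> (snd z)\<bar>) \<le> B"
      by (rule integrable_pair_section_bound)
        (use sb2 B E.prob_space_axioms lborel.sigma_finite_measure_axioms in auto)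
    have swap: "(LINT z|(lborel \<Otimes>\<^sub>M ?E). k (fst z - snd z) * \<mu> (fst z))
        = (LINT z|(?E \<Otimes>\<^sub>M lborel). k (snd z - fst z) * \<mu> (snd z))"
      if [measurable]: "k \<in> borel_measurable borel" for k
      by (subst LE.integral_product_swap[symmetric]) (auto simp: split_beta')
    show ?thesis
      unfolding swap[OF h_meas] swap[OF g\<eta>]
      using integral_add_diff_le_integral_abs[OF conjunct1[OF *],
          of "\<lambda>z. g\<^sub>\<eta> (snd z - fst z) * \<mu> (snd z)"] *
      by (simp add: h_eq ring_distribs)
  qed
  have T4: "(LINT z|(lborel \<Otimes>\<^sub>M lborel). (g (fst z - snd z) - g\<^sub>\<eta> (fst z - snd z)) * (\<mu> (fst z) * \<mu> (snd z)))
      + (LINT z|(lborel \<Otimes>\<^sub>M lborel). g\<^sub>\<eta> (fst z - snd z) * (\<mu> (fst z) * \<mu> (snd z)))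
      = (LINT z|(lborel \<Otimes>\<^sub>M lborel). h (fst z - snd z) * (\<mu> (fst z) * \<mu> (snd z)))"
  proof -
    have "(\<integral>\<^sup>+ z. ennreal \<bar>f (fst z - snd z) * (\<mu> (fst z) * \<mu> (snd z))\<bar> \<partial>(lborel \<Otimes>\<^sub>M lborel))
        = (\<integral>\<^sup>+ x. \<integral>\<^sup>+ y. ennreal \<bar>\<mu> x\<bar> * ennreal \<bar>f (x - y) * \<mu> y\<bar> \<partial>lborel \<partial>lborel)"
      by (subst lborel.nn_integral_fst[symmetric])
        (auto simp: abs_mult ennreal_mult[symmetric] mult_ac)
    also have "\<dots> = (\<integral>\<^sup>+ x. ennreal \<bar>\<mu> x\<bar> * (\<integral>\<^sup>+ y. ennreal \<bar>f (x - y) * \<mu> y\<bar> \<partial>lborel) \<partial>lborel)"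
      by (intro nn_integral_cong nn_integral_cmult) measurable
    also have "\<dots> \<le> (\<integral>\<^sup>+ x. ennreal \<bar>\<mu> x\<bar> * ennreal B \<partial>lborel)"
      by (intro nn_integral_mono mult_left_mono sb1) auto
    also have "\<dots> = (\<integral>\<^sup>+ x. ennreal \<bar>\<mu> x\<bar> \<partial>lborel) * ennreal B"
      by (rule nn_integral_multc) measurable
    also have "\<dots> < \<infinity>"
      using \<mu> by (auto simp: integrable_iff_bounded ennreal_mult_less_top)
    finally have f_int: "integrable (lborel \<Otimes>\<^sub>M lborel) (\<lambda>z. f (fst z - snd z) * (\<mu> (fst z) * \<mu> (snd z)))"
      by (intro integrableI_bounded) auto
    have "(LINT z|(lborel \<Otimes>\<^sub>M lborel). (g (fst z - snd z) - g\<^sub>\<eta> (fst z - snd z)) * (\<mu> (fst z) * \<mu> (snd z)))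
        = (LINT z|(lborel \<Otimes>\<^sub>M lborel). f (fst z - snd z) * (\<mu> (fst z) * \<mu> (snd z)))"
      using AE_lborel_pair_neq
      by (intro integral_cong_AE) (auto elim!: eventually_mono simp: f_def h_def)
    moreover have "integrable (lborel \<Otimes>\<^sub>M lborel) (\<lambda>z. g\<^sub>\<eta> (fst z - snd z) * (\<mu> (fst z) * \<mu> (snd z)))"
      using int
    proof
      assume "integrable (lborel \<Otimes>\<^sub>M lborel) (\<lambda>(x, y). g (x - y) * (\<mu> x * \<mu> y))"
      then have "integrable (lborel \<Otimes>\<^sub>M lborel)
          (\<lambda>z. (case z of (x, y) \<Rightarrow> g (x - y) * (\<mu> x * \<mu> y)) - f (fst z - snd z) * (\<mu> (fst z) * \<mu> (snd z)))"
        using f_int by (rule Bochner_Integration.integrable_diff)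
      then show ?thesis
        by (rule integrable_cong_AE_imp)
          (use AE_lborel_pair_neq in \<open>auto elim!: eventually_mono simp: f_def h_def split_beta' algebra_simps\<close>)
    qed (simp add: split_beta')
    ultimately show ?thesis
      using f_int by (simp add: h_eq ring_distribs split_beta')
  qed
  have offdiag: "indicator (- {(x, y). x = y}) z *\<^sub>R (case z of (x, y) \<Rightarrow> g (x - y)) = h (fst z - snd z)" for z
    by (auto simp: h_def indicator_def)
  have offdiag': "indicator (- {(x, y). x = y}) z *\<^sub>R ((case z of (x, y) \<Rightarrow> g (x - y)) * w) = h (fst z - snd z) * w" for z w
    by (auto simp: h_def indicator_def)
  have F: "2 * modulated_energy g N X \<mu> = (LINT z|(?E \<Otimes>\<^sub>M ?E). h (fst z - snd z))
     - (LINT z|(?E \<Otimes>\<^sub>M lborel). h (fst z - snd z) * \<mu> (snd z))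
     - (LINT z|(lborel \<Otimes>\<^sub>M ?E). h (fst z - snd z) * \<mu> (fst z))
     + (LINT z|(lborel \<Otimes>\<^sub>M lborel). h (fst z - snd z) * (\<mu> (fst z) * \<mu> (snd z)))"
    unfolding modulated_energy_def diff_square_integral_def set_lebesgue_integral_def offdiag offdiag'
    by simp
  have G: "diff_square_integral ?E \<mu> UNIV (\<lambda>(x, y). g\<^sub>\<eta> (x - y)) = (LINT z|(?E \<Otimes>\<^sub>M ?E). g\<^sub>\<eta> (fst z - snd z))
     - (LINT z|(?E \<Otimes>\<^sub>M lborel). g\<^sub>\<eta> (fst z - snd z) * \<mu> (snd z))
     - (LINT z|(lborel \<Otimes>\<^sub>M ?E). g\<^sub>\<eta> (fst z - snd z) * \<mu> (fst z))
     + (LINT z|(lborel \<Otimes>\<^sub>M lborel). g\<^sub>\<eta> (fst z - snd z) * (\<mu> (fst z) * \<mu> (snd z)))"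
    unfolding diff_square_integral_def set_lebesgue_integral_def by (simp add: split_beta')
  have half: "1 / (2 * (real N)\<^sup>2) * S = 1 / 2 * (1 / (real N)\<^sup>2 * S)" "g\<^sub>\<eta> 0 / (2 * real N) = 1 / 2 * (g\<^sub>\<eta> 0 / real N)" for S
    by auto
  have combine: "1 / 2 * a + 1 / 2 * b + 1 / 2 * (e\<^sub>1 - e\<^sub>2 - e\<^sub>3 + e\<^sub>4) \<le> F + 1 / 2 * z + B"
    if "2 * F = h\<^sub>1 - h\<^sub>2 - h\<^sub>3 + h\<^sub>4" "a + e\<^sub>1 = h\<^sub>1 + z" "h\<^sub>2 - e\<^sub>2 \<le> B" "h\<^sub>3 - e\<^sub>3 \<le> B" "b + e\<^sub>4 = h\<^sub>4"
    for a b e\<^sub>1 e\<^sub>2 e\<^sub>3 e\<^sub>4 h\<^sub>1 h\<^sub>2 h\<^sub>3 h\<^sub>4 F z :: real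
    using that by (simp add: field_simps)
  show ?thesis
    unfolding half G unfolding split_beta' by (rule combine[OF F T1 T2 T3 T4])
qed

section \<open>Admissible profiles and Hoelder's inequality\<close>

lemma admissible_profileD:
  fixes \<phi> :: "'a::euclidean_space \<Rightarrow> real"
  assumes "admissible_profile s \<phi>"
  shows admissible_profile_nonneg: "0 \<le> \<phi> x"
    and admissible_profile_continuous: "continuous_on UNIV \<phi>"
    and admissible_profile_integrable: "integrable lborel \<phi>"
    and admissible_profile_even: "\<phi> (- x) = \<phi> x"
    and admissible_profile_le_0: "\<phi> x \<le> \<phi> 0"
    and admissible_profile_0_pos: "0 < \<phi> 0"
    and profile_0: "profile \<phi> 0 = \<phi> 0"
proof -
  note * = assms[unfolded admissible_profile_def]
  have radial: "radial \<phi>" using * by (elim conjE)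
  have mono: "antimono_on {0..} (profile \<phi>)" using * by (elim conjE)
  have ex: "\<exists>x. \<phi> x \<noteq> 0" using * by (elim conjE)
  have "\<forall>x. 0 \<le> \<phi> x" using * by (elim conjE)
  then show nonneg: "0 \<le> \<phi> x" for x by blast
  show "continuous_on UNIV \<phi>" using * by (elim conjE)
  show "integrable lborel \<phi>" using * by (elim conjE)
  have radial: "\<phi> x = \<phi> y" if "norm x = norm y" for x y
    using radial that unfolding radial_def by blast
  show "\<phi> (- x) = \<phi> x"
    by (rule radial) simp
  show p0: "profile \<phi> 0 = \<phi> 0"
    by (simp add: profile_def)
  have le: "\<phi> x \<le> \<phi> 0" for x
  proof -
    have "(SOME b. b \<in> Basis) \<in> (Basis :: 'a set)"
      using nonempty_Basis by (simp add: some_in_eq)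
    then have "\<phi> x = profile \<phi> (norm x)"
      unfolding profile_def by (intro radial) simp
    also have "\<dots> \<le> profile \<phi> 0"
      by (rule monotone_onD[OF mono]) auto
    finally show ?thesis by (simp add: p0)
  qed
  then show "\<phi> x \<le> \<phi> 0" .
  obtain z where "\<phi> z \<noteq> 0" using ex by blast
  with nonneg[of z] le[of z] show "0 < \<phi> 0" by linarith
qed

lemma admissible_profile_measurable: "admissible_profile s \<phi> \<Longrightarrow> \<phi> \<in> borel_measurable borel"
  by (intro borel_measurable_continuous_onI admissible_profile_continuous)

lemma admissible_profile_decay:
  fixes \<phi> :: "'a::euclidean_space \<Rightarrow> real"
  assumes \<phi>: "admissible_profile s \<phi>" and s: "0 \<le> s"
  obtains \<gamma> C where "\<gamma> > s" "C \<ge> 0" "\<And>x. x \<noteq> 0 \<Longrightarrow> \<phi> x \<le> C * norm x powr (- \<gamma>)"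
proof -
  obtain \<gamma> C where \<gamma>: "\<gamma> > s" and C: "\<And>x. \<phi> x \<le> C * japanese x powr (- \<gamma>)"
    using \<phi> unfolding admissible_profile_def by blast
  have C0: "0 \<le> C"
    using C[of 0] admissible_profile_0_pos[OF \<phi>] by (simp add: japanese_def)
  have "\<phi> x \<le> C * norm x powr (- \<gamma>)" if "x \<noteq> 0" for x
  proof -
    have "norm x \<le> japanese x"
      unfolding japanese_def by (intro real_le_rsqrt) simp
    then have "japanese x powr (- \<gamma>) \<le> norm x powr (- \<gamma>)"
      using \<gamma> s that by (intro powr_mono2') auto
    with C[of x] C0 show ?thesis
      by (meson mult_left_mono order_trans)
  qed
  with \<gamma> C0 show ?thesis by (intro that)
qed

lemma c_const_nonneg:
  assumes \<phi>: "admissible_profile s \<phi>" and s: "0 \<le> s"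
  shows "0 \<le> c_const s \<phi>"
proof (cases "s = 0")
  case True
  then show ?thesis
    using admissible_profile_0_pos[OF \<phi>] by (simp add: c_const_def profile_0[OF \<phi>])
next
  case False
  have "0 \<le> (LINT r:{0<..}|lborel. r powr (s - 1) * profile \<phi> r)"
    unfolding set_lebesgue_integral_def profile_def
    by (intro Bochner_Integration.integral_nonneg) (auto simp: admissible_profile_nonneg[OF \<phi>])
  with False s show ?thesis by (simp add: c_const_def)
qed

text \<open>
  The threshold \<open>p > d / (d - s)\<close> says that the power of \<open>\<eta>\<close> in the error term is positive, which is
  what makes the small scales summable.
\<close>

lemma inv_conj_exponent_gt:
  assumes d: "0 \<le> s" "s < d" and p: "ereal (d / (d - s)) < p"
  shows "1 < p" and "s < d * inv_conj_exponent p"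
proof -
  have "1 \<le> d / (d - s)" using d by (simp add: field_simps)
  then have "1 \<le> ereal (d / (d - s))" by simp
  then show "1 < p" using p by (rule order.strict_trans1)
  show "s < d * inv_conj_exponent p"
  proof (cases p)
    case (real q)
    with p d have q: "d / (d - s) < q" by simp
    with \<open>1 \<le> d / (d - s)\<close> have "q > 0" by linarith
    with q d show ?thesis by (simp add: real inv_conj_exponent_def field_simps)
  qed (use p d in \<open>auto simp: inv_conj_exponent_def\<close>)
qed

lemma Lp_norm_nonneg: "0 \<le> Lp_norm p f" for f :: "'a::euclidean_space \<Rightarrow> real"
proof (cases "p = \<infinity>")
  case True
  have "\<exists>x. ereal \<bar>f x\<bar> \<le> esssup lborel (\<lambda>x. ereal \<bar>f x\<bar>)"
    by (rule eventually_happens'[OF _ esssup_AE]) (simp add: ae_filter_eq_bot_iff)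
  then have "0 \<le> esssup lborel (\<lambda>x. ereal \<bar>f x\<bar>)"
    by (meson abs_ge_zero ereal_less_eq(5) order_trans)
  with True show ?thesis by (simp add: Lp_norm_def real_of_ereal_pos)
qed (simp add: Lp_norm_def)

text \<open>
  The essential supremum is an extended real; the bound in \<open>in_Lp \<infinity>\<close> makes it finite, so that its
  real part is still an almost everywhere bound.
\<close>

lemma AE_abs_le_Lp_norm_infinity:
  fixes f :: "'a::euclidean_space \<Rightarrow> real"
  assumes "in_Lp \<infinity> f"
  shows "AE x in lborel. \<bar>f x\<bar> \<le> Lp_norm \<infinity> f"
proof -
  let ?S = "esssup lborel (\<lambda>x. ereal \<bar>f x\<bar>)"
  obtain B where B: "AE x in lborel. \<bar>f x\<bar> \<le> B" and [measurable]: "f \<in> borel_measurable lborel"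
    using assms by (auto simp: in_Lp_def)
  have "?S \<le> ereal B"
    using B by (intro esssup_I) auto
  moreover have S: "AE x in lborel. ereal \<bar>f x\<bar> \<le> ?S"
    by (rule esssup_AE)
  moreover have "\<exists>x. ereal \<bar>f x\<bar> \<le> ?S"
    by (rule eventually_happens'[OF _ S]) (simp add: ae_filter_eq_bot_iff)
  then have "?S \<noteq> - \<infinity>" by auto
  ultimately obtain r where "?S = ereal r" by (cases ?S) auto
  with S show ?thesis by (simp add: Lp_norm_def)
qed

text \<open>
  Hoelder's inequality for \<open>\<phi>\<close> dilated by \<open>t\<close> against \<open>\<mu>\<close>: the conjugate norm of \<open>\<phi>\<close> is
  finite because \<open>\<phi>\<close> is bounded and integrable, and dilation multiplies it by
  \<open>t powr (d * (p - 1) / p)\<close>.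
\<close>

lemma convolution_profile_le_Lp_norm:
  fixes \<phi> :: "'a::euclidean_space \<Rightarrow> real"
  assumes \<phi>: "admissible_profile s \<phi>" and p: "1 < p"
  obtains A where "0 \<le> A"
    "\<And>\<mu> t x. in_Lp p \<mu> \<Longrightarrow> 0 < t \<Longrightarrow>
      (\<integral>\<^sup>+ y. ennreal (\<phi> ((x - y) /\<^sub>R t) * \<bar>\<mu> y\<bar>) \<partial>lborel)
        \<le> ennreal (A * t powr (real DIM('a) * inv_conj_exponent p) * Lp_norm p \<mu>)"
proof -
  note [measurable] = admissible_profile_measurable[OF \<phi>]
  note nonneg = admissible_profile_nonneg[OF \<phi>]
  have scale: "(\<integral>\<^sup>+ y. F ((x - y) /\<^sub>R t) \<partial>lborel) = ennreal (t ^ DIM('a)) * (\<integral>\<^sup>+ y. F y \<partial>lborel)"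
    if [measurable]: "F \<in> borel_measurable borel" and t: "0 < t" for F :: "'a \<Rightarrow> ennreal" and x t
  proof -
    have "(\<integral>\<^sup>+ y. F ((x - y) /\<^sub>R t) \<partial>lborel)
        = (\<integral>\<^sup>+ y. F ((x - y) /\<^sub>R t) \<partial>density (distr lborel borel (\<lambda>u. x + (- t) *\<^sub>R u)) (\<lambda>_. \<bar>- t\<bar> ^ DIM('a)))"
      by (subst lborel_affine[of "- t" x, symmetric]) (use t in auto)
    also have "\<dots> = ennreal (t ^ DIM('a)) * (\<integral>\<^sup>+ y. F y \<partial>lborel)"
      using t by (subst nn_integral_density)
        (auto simp: nn_integral_distr nn_integral_cmult ennreal_power)
    finally show ?thesis .
  qed
  show ?thesis
  proof (cases "p = \<infinity>")
    case True
    define A where "A = (LINT x|lborel. \<phi> x)"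
    have nnA: "(\<integral>\<^sup>+ y. ennreal (\<phi> y) \<partial>lborel) = ennreal A"
      unfolding A_def
      by (intro nn_integral_eq_integral admissible_profile_integrable[OF \<phi>]) (simp add: nonneg)
    have A0: "0 \<le> A" by (simp add: A_def nonneg)
    show ?thesis
    proof (rule that[OF A0])
      fix \<mu> :: "'a \<Rightarrow> real" and t :: real and x :: 'a
      assume \<mu>: "in_Lp p \<mu>" and t: "0 < t"
      have "(\<integral>\<^sup>+ y. ennreal (\<phi> ((x - y) /\<^sub>R t) * \<bar>\<mu> y\<bar>) \<partial>lborel)
          \<le> (\<integral>\<^sup>+ y. ennreal (\<phi> ((x - y) /\<^sub>R t)) * ennreal (Lp_norm p \<mu>) \<partial>lborel)"
        using AE_abs_le_Lp_norm_infinity[of \<mu>] \<mu> True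
        by (intro nn_integral_mono_AE)
          (auto elim!: eventually_mono simp: ennreal_mult' nonneg Lp_norm_nonneg
            intro!: mult_left_mono ennreal_leI)
      also have "\<dots> = ennreal (t ^ DIM('a)) * ennreal A * ennreal (Lp_norm p \<mu>)"
        using t by (simp add: nn_integral_multc scale[of "\<lambda>y. ennreal (\<phi> y)"] nnA)
      also have "\<dots> = ennreal (A * t powr (real DIM('a) * inv_conj_exponent p) * Lp_norm p \<mu>)"
        using t A0 by (simp add: ennreal_mult[symmetric] Lp_norm_nonneg True inv_conj_exponent_def
            powr_realpow mult_ac)
      finally show "(\<integral>\<^sup>+ y. ennreal (\<phi> ((x - y) /\<^sub>R t) * \<bar>\<mu> y\<bar>) \<partial>lborel)
          \<le> ennreal (A * t powr (real DIM('a) * inv_conj_exponent p) * Lp_norm p \<mu>)" .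
    qed
  next
    case False
    with p obtain q where p: "p = ereal q" and q: "1 < q" by (cases p) auto
    define r where "r = q / (q - 1)"
    have r: "1 < r" "1 / r + 1 / q = 1" using q by (auto simp: r_def field_simps)
    have conj: "inv_conj_exponent p = 1 / r" using q by (simp add: p inv_conj_exponent_def r_def)
    define I where "I = (LINT x|lborel. \<phi> x powr r)"
    have \<phi>_r: "integrable lborel (\<lambda>x. \<phi> x powr r)"
    proof (rule Bochner_Integration.integrable_bound)
      show "integrable lborel (\<lambda>x. \<phi> 0 powr (r - 1) * \<phi> x)"
        by (intro integrable_mult_right admissible_profile_integrable[OF \<phi>])
      have "\<phi> x powr r \<le> \<phi> 0 powr (r - 1) * \<phi> x" for x
      proof (cases "\<phi> x = 0")
        case False
        then have "\<phi> x powr r = \<phi> x powr (r - 1) * \<phi> x"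
          using nonneg[of x] by (simp add: powr_diff)
        also have "\<dots> \<le> \<phi> 0 powr (r - 1) * \<phi> x"
          using r nonneg admissible_profile_le_0[OF \<phi>] by (intro mult_right_mono powr_mono2) auto
        finally show ?thesis .
      qed auto
      then show "AE x in lborel. norm (\<phi> x powr r) \<le> norm (\<phi> 0 powr (r - 1) * \<phi> x)"
        using nonneg by simp
    qed measurable
    have nnI: "(\<integral>\<^sup>+ y. ennreal (\<phi> y powr r) \<partial>lborel) = ennreal I"
      unfolding I_def by (intro nn_integral_eq_integral \<phi>_r) simp
    have I0: "0 \<le> I" by (simp add: I_def)
    show ?thesis
    proof (rule that)
      show "0 \<le> (I + 1) powr (1 / r)" by simp
      fix \<mu> :: "'a \<Rightarrow> real" and t :: real and x :: 'a
      assume \<mu>: "in_Lp p \<mu>" and t: "0 < t"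
      let ?m = "Lp_norm p \<mu>"
      have \<mu>_q: "integrable lborel (\<lambda>x. \<bar>\<mu> x\<bar> powr q)" and [measurable]: "\<mu> \<in> borel_measurable borel"
        using \<mu> by (auto simp: in_Lp_def p)
      have m: "?m = (LINT x|lborel. \<bar>\<mu> x\<bar> powr q) powr (1 / q)"
        by (simp add: Lp_norm_def p)
      show "(\<integral>\<^sup>+ y. ennreal (\<phi> ((x - y) /\<^sub>R t) * \<bar>\<mu> y\<bar>) \<partial>lborel)
          \<le> ennreal ((I + 1) powr (1 / r) * t powr (real DIM('a) * inv_conj_exponent p) * ?m)"
      proof (cases "(LINT x|lborel. \<bar>\<mu> x\<bar> powr q) = 0")
        case True
        with \<mu>_q have "AE x in lborel. \<bar>\<mu> x\<bar> powr q = 0"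
          by (simp add: integral_nonneg_eq_0_iff_AE)
        then have "(\<integral>\<^sup>+ y. ennreal (\<phi> ((x - y) /\<^sub>R t) * \<bar>\<mu> y\<bar>) \<partial>lborel) = 0"
          by (subst nn_integral_0_iff_AE) (auto elim!: eventually_mono)
        then show ?thesis by simp
      next
        case False
        then have J: "0 < (LINT x|lborel. \<bar>\<mu> x\<bar> powr q)"
          by (simp add: less_le)
        then have m0: "0 < ?m" by (simp add: m)
        have mq: "?m powr q = (LINT x|lborel. \<bar>\<mu> x\<bar> powr q)"
          using J q by (simp add: m powr_powr)
        \<comment> \<open>Hoelder's inequality comes from Young's after normalising both factors.  The number \<open>\<alpha>\<close>
            bounds the conjugate norm of the dilated profile; \<open>I + 1\<close> in place of \<open>I\<close> keeps it
            positive without a separate argument.\<close>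
        define \<alpha> where "\<alpha> = (I + 1) powr (1 / r) * t powr (real DIM('a) / r)"
        have \<alpha>0: "0 < \<alpha>" using t I0 by (simp add: \<alpha>_def)
        have \<alpha>r: "\<alpha> powr r = (I + 1) * t ^ DIM('a)"
          using r t I0 by (simp add: \<alpha>_def powr_mult powr_powr powr_realpow)
        have young: "\<phi> ((x - y) /\<^sub>R t) * \<bar>\<mu> y\<bar>
            \<le> \<alpha> * ?m / (\<alpha> powr r * r) * \<phi> ((x - y) /\<^sub>R t) powr r
              + \<alpha> * ?m / (?m powr q * q) * \<bar>\<mu> y\<bar> powr q" for y
        proof -
          have "\<phi> ((x - y) /\<^sub>R t) / \<alpha> * (\<bar>\<mu> y\<bar> / ?m)
              \<le> (\<phi> ((x - y) /\<^sub>R t) / \<alpha>) powr r / r + (\<bar>\<mu> y\<bar> / ?m) powr q / q"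
            using r q \<alpha>0 m0 nonneg by (intro Youngs_inequality) auto
          then have "\<alpha> * ?m * (\<phi> ((x - y) /\<^sub>R t) / \<alpha> * (\<bar>\<mu> y\<bar> / ?m))
              \<le> \<alpha> * ?m * ((\<phi> ((x - y) /\<^sub>R t) / \<alpha>) powr r / r + (\<bar>\<mu> y\<bar> / ?m) powr q / q)"
            using \<alpha>0 m0 by (intro mult_left_mono) auto
          moreover have "\<alpha> * ?m * (\<phi> ((x - y) /\<^sub>R t) / \<alpha> * (\<bar>\<mu> y\<bar> / ?m)) = \<phi> ((x - y) /\<^sub>R t) * \<bar>\<mu> y\<bar>"
            using \<alpha>0 m0 by simp
          ultimately show ?thesis
            using \<alpha>0 m0 nonneg by (simp add: powr_divide distrib_left)
        qed
        have "(\<integral>\<^sup>+ y. ennreal (\<phi> ((x - y) /\<^sub>R t) * \<bar>\<mu> y\<bar>) \<partial>lborel)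
            \<le> (\<integral>\<^sup>+ y. ennreal (\<alpha> * ?m / (\<alpha> powr r * r)) * ennreal (\<phi> ((x - y) /\<^sub>R t) powr r)
              + ennreal (\<alpha> * ?m / (?m powr q * q)) * ennreal (\<bar>\<mu> y\<bar> powr q) \<partial>lborel)"
          using young \<alpha>0 m0 r q
          by (intro nn_integral_mono) (simp add: ennreal_mult[symmetric] ennreal_plus[symmetric] ennreal_leI del: ennreal_plus)
        also have "\<dots> = ennreal (\<alpha> * ?m / (\<alpha> powr r * r)) * (ennreal (t ^ DIM('a)) * ennreal I)
            + ennreal (\<alpha> * ?m / (?m powr q * q)) * ennreal (?m powr q)"
          using t by (simp add: nn_integral_add nn_integral_cmult scale[of "\<lambda>y. ennreal (\<phi> y powr r)"] nnI mq
              nn_integral_eq_integral[OF \<mu>_q])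
        also have "\<dots> = ennreal (\<alpha> * ?m / (\<alpha> powr r * r) * (t ^ DIM('a) * I) + \<alpha> * ?m / (?m powr q * q) * ?m powr q)"
          using \<alpha>0 m0 r q t I0
          by (simp add: ennreal_mult[symmetric] ennreal_plus[symmetric] del: ennreal_plus)
        also have "\<dots> \<le> ennreal (\<alpha> * ?m)"
        proof (rule ennreal_leI)
          have "t ^ DIM('a) * I / (\<alpha> powr r * r) \<le> 1 / r"
          proof -
            have "t ^ DIM('a) * I \<le> \<alpha> powr r"
              using t unfolding \<alpha>r by (simp add: algebra_simps)
            then have "t ^ DIM('a) * I / \<alpha> powr r / r \<le> 1 / r"
              using \<alpha>0 r by (intro divide_right_mono) auto
            then show ?thesis by simp
          qed
          then have "\<alpha> * ?m * (t ^ DIM('a) * I / (\<alpha> powr r * r)) + \<alpha> * ?m * (1 / q)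
              \<le> \<alpha> * ?m * (1 / r) + \<alpha> * ?m * (1 / q)"
            using \<alpha>0 m0 by (intro add_right_mono mult_left_mono) auto
          also have "\<dots> = \<alpha> * ?m"
            by (simp only: distrib_left[symmetric] r mult_1_right)
          finally show "\<alpha> * ?m / (\<alpha> powr r * r) * (t ^ DIM('a) * I) + \<alpha> * ?m / (?m powr q * q) * ?m powr q \<le> \<alpha> * ?m"
            using m0 q by simp
        qed
        finally show ?thesis by (simp add: \<alpha>_def conj)
      qed
    qed
  qed
qed

section \<open>Superpositions over scales\<close>

lemma nn_integral_powr_from_0:
  assumes "-1 < a" "0 \<le> c"
  shows "(\<integral>\<^sup>+ t. ennreal (indicator {0<..c} t * t powr a) \<partial>lborel) = ennreal (c powr (a + 1) / (a + 1))"
proof -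
  have "(\<integral>\<^sup>+ t. ennreal (indicator {0<..c} t * t powr a) \<partial>lborel)
      = (\<integral>\<^sup>+ t. ennreal (indicator {0..c} t * t powr a) \<partial>lborel)"
    by (intro nn_integral_cong) (auto simp: indicator_def)
  also have "\<dots> = ennreal (c powr (a + 1) / (a + 1))"
    by (rule nn_integral_has_integral_lebesgue[OF _ has_integral_powr_from_0[OF assms]]) simp
  finally show ?thesis .
qed

lemma nn_integral_powr_to_inf:
  assumes "a < -1" "0 < c"
  shows "(\<integral>\<^sup>+ t. ennreal (indicator {c..} t * t powr a) \<partial>lborel) = ennreal (- (c powr (a + 1)) / (a + 1))"
  by (rule nn_integral_has_integral_lebesgue[OF _ has_integral_powr_to_inf[OF assms]]) simp

lemma set_integrable_powr_from_0:
  fixes a c :: real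
  assumes "-1 < a" "0 \<le> c"
  shows "set_integrable lborel {0<..c} (\<lambda>t. t powr a)"
proof -
  have "has_bochner_integral lborel (\<lambda>t. indicator {0<..c} t * t powr a) (c powr (a + 1) / (a + 1))"
    by (rule has_bochner_integral_nn_integral[OF _ _ _ nn_integral_powr_from_0[OF assms]])
      (use assms in auto)
  then show ?thesis
    by (auto simp: set_integrable_def has_bochner_integral_iff)
qed

lemma
  fixes a c :: real
  assumes "a < -1" "0 < c"
  shows set_integrable_powr_to_inf: "set_integrable lborel {c..} (\<lambda>t. t powr a)"
    and set_integral_powr_to_inf: "(LINT t:{c..}|lborel. t powr a) = - (c powr (a + 1)) / (a + 1)"
proof -
  have "has_bochner_integral lborel (\<lambda>t. indicator {c..} t * t powr a) (- (c powr (a + 1)) / (a + 1))"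
    by (rule has_bochner_integral_nn_integral[OF _ _ _ nn_integral_powr_to_inf[OF assms]])
      (use assms in \<open>auto simp: divide_nonneg_neg\<close>)
  then show "set_integrable lborel {c..} (\<lambda>t. t powr a)" "(LINT t:{c..}|lborel. t powr a) = - (c powr (a + 1)) / (a + 1)"
    by (auto simp: set_integrable_def set_lebesgue_integral_def has_bochner_integral_iff)
qed

lemma locally_integrable_pos_measurable:
  assumes "locally_integrable_pos f"
  shows "(\<lambda>t. indicator {0<..} t * f t) \<in> borel_measurable borel"
proof (rule borel_measurable_LIMSEQ_real)
  fix n :: nat
  have "0 < inverse (real (Suc n))" and "inverse (real (Suc n)) \<le> real (Suc n)"
    by (auto intro: order_trans[OF inverse_le_1_iff[THEN iffD2]])
  with assms have "set_integrable lborel {inverse (real (Suc n))..real (Suc n)} f"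
    unfolding locally_integrable_pos_def by blast
  then show "(\<lambda>t. indicator {inverse (real (Suc n))..real (Suc n)} t * f t) \<in> borel_measurable borel"
    by (auto simp: set_integrable_def)
next
  fix t :: real
  show "(\<lambda>n. indicator {inverse (real (Suc n))..real (Suc n)} t * f t) \<longlonglongrightarrow> indicator {0<..} t * f t"
  proof (cases "0 < t")
    case True
    have "eventually (\<lambda>n. inverse (real (Suc n)) < t) sequentially"
      using LIMSEQ_inverse_real_of_nat True by (rule order_tendstoD)
    moreover have "eventually (\<lambda>n. t \<le> real n) sequentially"
      by (rule eventually_at_top_linorderI[of "nat \<lceil>t\<rceil>"]) linarith
    ultimately have "eventually (\<lambda>n. indicator {inverse (real (Suc n))..real (Suc n)} t * f t
        = indicator {0<..} t * f t) sequentially"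
      by eventually_elim (use True in \<open>auto simp: indicator_def\<close>)
    then show ?thesis by (rule tendsto_eventually)
  next
    case False
    then have "t < inverse (real (Suc n))" for n
      by (smt (verit) inverse_positive_iff_positive of_nat_0_less_iff zero_less_Suc)
    then have "indicator {inverse (real (Suc n))..real (Suc n)} t = (0 :: real)" for n
      by (simp add: indicator_def not_le)
    with False show ?thesis by simp
  qed
qed

definition scale_integral ::
  "('a::euclidean_space \<Rightarrow> real) \<Rightarrow> (real \<Rightarrow> real) \<Rightarrow> real set \<Rightarrow> 'a \<Rightarrow> real" where
  "scale_integral \<phi> z A x = (LINT t:A|lborel. z t * scaled \<phi> t x / t)"

text \<open>
  Measurability is asked for only on \<open>(0, \<infinity>)\<close>, because the weights of an admissible potential are
  arbitrary elsewhere.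
\<close>

definition scale_weight :: "real \<Rightarrow> real \<Rightarrow> (real \<Rightarrow> real) \<Rightarrow> bool" where
  "scale_weight K a z \<longleftrightarrow> (\<lambda>t. indicator {0<..} t * z t) \<in> borel_measurable borel \<and>
     (\<forall>t>0. 0 \<le> z t \<and> z t \<le> K * t powr a)"

lemma scale_weight_const_nonneg: "scale_weight K a z \<Longrightarrow> 0 \<le> K"
  unfolding scale_weight_def by (drule conjunct2, drule spec[of _ 1]) simp

lemma scale_integrand_measurable:
  fixes \<phi> :: "'a::euclidean_space \<Rightarrow> real"
  assumes \<phi>: "admissible_profile s \<phi>"
    and z: "(\<lambda>t. indicator {0<..} t * z t) \<in> borel_measurable borel"
    and A: "A \<in> sets borel" "A \<subseteq> {0<..}"
  shows "(\<lambda>(x, t). indicator A t *\<^sub>R (z t * scaled \<phi> t x / t)) \<in> borel_measurable (borel \<Otimes>\<^sub>M borel)"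
proof -
  note [measurable] = admissible_profile_measurable[OF \<phi>] z A(1)
  have "(\<lambda>(x, t). indicator A t * ((indicator {0<..} t * z t) * (\<phi> (x /\<^sub>R t) / t ^ DIM('a)) / t))
      \<in> borel_measurable (borel \<Otimes>\<^sub>M borel)"
    by measurable
  also have "(\<lambda>(x, t). indicator A t * ((indicator {0<..} t * z t) * (\<phi> (x /\<^sub>R t) / t ^ DIM('a)) / t))
      = (\<lambda>(x, t). indicator A t *\<^sub>R (z t * scaled \<phi> t x / t))"
    using A(2) by (auto simp: indicator_def scaled_def fun_eq_iff)
  finally show ?thesis .
qed

lemma scale_integrand_measurable_section:
  fixes \<phi> :: "'a::euclidean_space \<Rightarrow> real"
  assumes "admissible_profile s \<phi>" "(\<lambda>t. indicator {0<..} t * z t) \<in> borel_measurable borel"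
    "A \<in> sets borel" "A \<subseteq> {0<..}"
  shows "(\<lambda>t. indicator A t *\<^sub>R (z t * scaled \<phi> t x / t)) \<in> borel_measurable borel"
  using measurable_Pair2[OF scale_integrand_measurable[OF assms], of x] by simp

lemma scale_integral_measurable:
  fixes \<phi> :: "'a::euclidean_space \<Rightarrow> real"
  assumes "admissible_profile s \<phi>" "(\<lambda>t. indicator {0<..} t * z t) \<in> borel_measurable borel"
    "A \<in> sets borel" "A \<subseteq> {0<..}"
  shows "scale_integral \<phi> z A \<in> borel_measurable borel"
proof -
  have "(\<lambda>(x, t). indicator A t *\<^sub>R (z t * scaled \<phi> t x / t)) \<in> borel_measurable (borel \<Otimes>\<^sub>M lborel)"
    using scale_integrand_measurable[OF assms] by simp
  then have "(\<lambda>x. LINT t|lborel. indicator A t *\<^sub>R (z t * scaled \<phi> t x / t)) \<in> borel_measurable borel"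
    by (rule lborel.borel_measurable_lebesgue_integral)
  then show ?thesis
    unfolding scale_integral_def set_lebesgue_integral_def .
qed

lemma scale_integral_nonneg:
  assumes "admissible_profile s \<phi>" "scale_weight K a z" "A \<subseteq> {0<..}"
  shows "0 \<le> scale_integral \<phi> z A x"
  unfolding scale_integral_def set_lebesgue_integral_def
  using assms by (intro Bochner_Integration.integral_nonneg)
    (auto simp: scale_weight_def scaled_def indicator_def admissible_profile_nonneg intro!: mult_nonneg_nonneg divide_nonneg_nonneg)

lemma scale_integral_even:
  assumes "admissible_profile s \<phi>"
  shows "scale_integral \<phi> z A (- x) = scale_integral \<phi> z A x"
  by (simp add: scale_integral_def scaled_def admissible_profile_even[OF assms])

text \<open>
  Away from the origin the decay of \<open>\<phi>\<close> with an exponent \<open>\<gamma> > s\<close> beats the singularity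
  \<open>t powr (- s - 1)\<close> of the weight at small scales.
\<close>

lemma scale_integrable_near:
  fixes \<phi> :: "'a::euclidean_space \<Rightarrow> real"
  assumes \<phi>: "admissible_profile s \<phi>" and s: "0 \<le> s"
    and z: "scale_weight K (real DIM('a) - s) z" and x: "x \<noteq> 0" and T: "0 \<le> T"
  shows "set_integrable lborel {0<..T} (\<lambda>t. z t * scaled \<phi> t x / t)"
proof -
  obtain \<gamma> C where \<gamma>: "\<gamma> > s" and C: "C \<ge> 0" and decay: "\<And>x. x \<noteq> 0 \<Longrightarrow> \<phi> x \<le> C * norm x powr (- \<gamma>)"
    by (rule admissible_profile_decay[OF \<phi> s]) blast
  have "set_integrable lborel {0<..T} (\<lambda>t. (K * C * norm x powr (- \<gamma>)) * t powr (\<gamma> - s - 1))"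
    using \<gamma> T by (intro set_integrable_mult_right set_integrable_powr_from_0) auto
  then show ?thesis
  proof (rule set_integrable_bound)
    have "{0<..T} \<subseteq> {0<..}" by auto
    then show "set_borel_measurable lborel {0<..T} (\<lambda>t. z t * scaled \<phi> t x / t)"
      unfolding set_borel_measurable_def
      using scale_integrand_measurable_section[OF \<phi>, of z "{0<..T}" x] z by (auto simp: scale_weight_def)
    have "norm (z t * scaled \<phi> t x / t) \<le> norm ((K * C * norm x powr (- \<gamma>)) * t powr (\<gamma> - s - 1))"
      if t: "0 < t" for t
    proof -
      have "0 \<le> z t" and zt: "z t \<le> K * t powr (real DIM('a) - s)" using z t by (auto simp: scale_weight_def)
      moreover have "0 \<le> \<phi> (x /\<^sub>R t)" by (rule admissible_profile_nonneg[OF \<phi>])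
      ultimately have "norm (z t * scaled \<phi> t x / t) = z t * (\<phi> (x /\<^sub>R t) / (t ^ DIM('a) * t))"
        using t by (simp add: scaled_def)
      also have "\<dots> \<le> (K * t powr (real DIM('a) - s)) * ((C * norm (x /\<^sub>R t) powr (- \<gamma>)) / (t ^ DIM('a) * t))"
        using t x zt \<open>0 \<le> z t\<close> \<open>0 \<le> \<phi> (x /\<^sub>R t)\<close> scale_weight_const_nonneg[OF z]
        by (intro mult_mono divide_right_mono decay) auto
      also have "\<dots> = (K * C * norm x powr (- \<gamma>)) * (t powr (real DIM('a) - s) * t powr \<gamma> / (t powr real DIM('a) * t))"
      proof -
        have "norm (x /\<^sub>R t) powr (- \<gamma>) = (norm x / t) powr (- \<gamma>)"
          using t by (simp add: divide_inverse mult.commute)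
        also have "\<dots> = norm x powr (- \<gamma>) * t powr \<gamma>"
          using t by (simp add: powr_divide powr_minus_divide)
        finally show ?thesis using t by (simp add: powr_realpow)
      qed
      also have "t powr (real DIM('a) - s) * t powr \<gamma> / (t powr real DIM('a) * t) = t powr (\<gamma> - s - 1)"
      proof -
        have "t powr real DIM('a) * t = t powr (real DIM('a) + 1)"
          using t by (simp add: powr_add)
        then show ?thesis
          unfolding powr_add[symmetric] by (simp add: powr_diff[symmetric] algebra_simps)
      qed
      finally show ?thesis
        using C scale_weight_const_nonneg[OF z] by simp
    qed
    then show "AE t in lborel. t \<in> {0<..T} \<longrightarrow> norm (z t * scaled \<phi> t x / t)
        \<le> norm ((K * C * norm x powr (- \<gamma>)) * t powr (\<gamma> - s - 1))" by auto
  qed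
qed

text \<open>
  For \<open>s > 0\<close> the scales above \<open>\<eta>\<close> converge using only \<open>\<phi> \<le> \<phi> 0\<close>.  Hence the bound is
  uniform in \<open>x\<close>, including the origin.
\<close>

lemma
  fixes \<phi> :: "'a::euclidean_space \<Rightarrow> real"
  assumes \<phi>: "admissible_profile s \<phi>" and s: "0 < s"
    and z: "scale_weight K (real DIM('a) - s) z" and \<eta>: "0 < \<eta>"
  shows scale_integrable_far: "set_integrable lborel {\<eta>..} (\<lambda>t. z t * scaled \<phi> t x / t)"
    and scale_integral_far_le: "scale_integral \<phi> z {\<eta>..} x \<le> K * \<phi> 0 * (\<eta> powr (- s) / s)"
proof -
  have bound: "z t * scaled \<phi> t x / t \<le> (K * \<phi> 0) * t powr (- s - 1)" if t: "0 < t" for t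
  proof -
    have "0 \<le> z t" and zt: "z t \<le> K * t powr (real DIM('a) - s)" using z t by (auto simp: scale_weight_def)
    then have "z t * scaled \<phi> t x / t \<le> (K * t powr (real DIM('a) - s)) * (\<phi> 0 / t ^ DIM('a)) / t"
      using t scale_weight_const_nonneg[OF z] admissible_profile_nonneg[OF \<phi>] admissible_profile_le_0[OF \<phi>]
      unfolding scaled_def by (intro divide_right_mono mult_mono) auto
    also have "\<dots> = (K * \<phi> 0) * (t powr (real DIM('a) - s) / (t powr real DIM('a) * t))"
      using t by (simp add: powr_realpow)
    also have "t powr (real DIM('a) - s) / (t powr real DIM('a) * t) = t powr (- s - 1)"
      using t by (simp add: powr_diff powr_minus field_simps)
    finally show ?thesis .
  qed
  have nonneg: "0 \<le> z t * scaled \<phi> t x / t" if "0 < t" for t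
    using z that admissible_profile_nonneg[OF \<phi>] by (simp add: scale_weight_def scaled_def)
  have int: "set_integrable lborel {\<eta>..} (\<lambda>t. (K * \<phi> 0) * t powr (- s - 1))"
    using s \<eta> by (intro set_integrable_mult_right set_integrable_powr_to_inf) auto
  then show *: "set_integrable lborel {\<eta>..} (\<lambda>t. z t * scaled \<phi> t x / t)"
  proof (rule set_integrable_bound)
    have "{\<eta>..} \<subseteq> {0<..}" using \<eta> by auto
    then show "set_borel_measurable lborel {\<eta>..} (\<lambda>t. z t * scaled \<phi> t x / t)"
      unfolding set_borel_measurable_def
      using scale_integrand_measurable_section[OF \<phi>, of z "{\<eta>..}" x] z by (auto simp: scale_weight_def)
    have "norm (z t * scaled \<phi> t x / t) \<le> norm ((K * \<phi> 0) * t powr (- s - 1))" if "0 < t" for t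
      using nonneg[OF that] bound[OF that] by simp
    then show "AE t in lborel. t \<in> {\<eta>..} \<longrightarrow> norm (z t * scaled \<phi> t x / t)
        \<le> norm ((K * \<phi> 0) * t powr (- s - 1))" using \<eta> by auto
  qed
  have "scale_integral \<phi> z {\<eta>..} x \<le> (LINT t:{\<eta>..}|lborel. (K * \<phi> 0) * t powr (- s - 1))"
    unfolding scale_integral_def using \<eta> by (intro set_integral_mono * int bound) auto
  also have "\<dots> = K * \<phi> 0 * (\<eta> powr (- s) / s)"
    using set_integral_powr_to_inf[of "- s - 1" \<eta>] s \<eta> by (simp add: field_simps)
  finally show "scale_integral \<phi> z {\<eta>..} x \<le> K * \<phi> 0 * (\<eta> powr (- s) / s)" .
qed

text \<open>
  By Tonelli the scales may be treated one at a time.  At scale \<open>t\<close> the profile estimate and the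
  weight give \<open>t powr (\<kappa> - s - 1)\<close> with \<open>\<kappa> = d * (p - 1) / p\<close>, which is integrable at \<open>0\<close> exactly when
  \<open>s < \<kappa>\<close>.
\<close>

lemma short_range_potential_bound:
  fixes \<phi> :: "'a::euclidean_space \<Rightarrow> real"
  assumes \<phi>: "admissible_profile s \<phi>" and s: "0 \<le> s"
    and p: "s < real DIM('a) * inv_conj_exponent p"
    and A: "0 \<le> A"
      "\<And>t. 0 < t \<Longrightarrow> (\<integral>\<^sup>+ y. ennreal (\<phi> ((x - y) /\<^sub>R t) * \<bar>\<mu> y\<bar>) \<partial>lborel)
        \<le> ennreal (A * t powr (real DIM('a) * inv_conj_exponent p) * Lp_norm p \<mu>)"
    and \<mu> [measurable]: "\<mu> \<in> borel_measurable borel"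
    and z: "scale_weight K (real DIM('a) - s) z" and \<eta>: "0 < \<eta>"
  shows "(\<integral>\<^sup>+ y. ennreal (scale_integral \<phi> z {0<..<\<eta>} (x - y) * \<bar>\<mu> y\<bar>) \<partial>lborel)
    \<le> ennreal (K * A / (real DIM('a) * inv_conj_exponent p - s) * Lp_norm p \<mu>
        * \<eta> powr (real DIM('a) * inv_conj_exponent p - s))"
proof -
  let ?\<kappa> = "real DIM('a) * inv_conj_exponent p" and ?m = "Lp_norm p \<mu>"
  define w where "w y t = indicator {0<..<\<eta>} t *\<^sub>R (z t * scaled \<phi> t (x - y) / t)" for y t
  have K: "0 \<le> K" by (rule scale_weight_const_nonneg[OF z])
  have w0: "0 \<le> w y t" for y t
    using z admissible_profile_nonneg[OF \<phi>]
    by (auto simp: w_def indicator_def scale_weight_def scaled_def)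
  have "(\<lambda>(x, t). indicator {0<..<\<eta>} t *\<^sub>R (z t * scaled \<phi> t x / t)) \<in> borel_measurable (borel \<Otimes>\<^sub>M borel)"
    using z by (intro scale_integrand_measurable[OF \<phi>]) (auto simp: scale_weight_def)
  then have "(\<lambda>q. case (x - fst q, snd q) of (x, t) \<Rightarrow> indicator {0<..<\<eta>} t *\<^sub>R (z t * scaled \<phi> t x / t))
      \<in> borel_measurable (borel \<Otimes>\<^sub>M borel)"
    by (rule measurable_compose[rotated]) measurable
  then have w [measurable]: "(\<lambda>(y, t). w y t) \<in> borel_measurable (borel \<Otimes>\<^sub>M borel)"
    by (simp add: w_def split_beta')
  have "(\<integral>\<^sup>+ y. ennreal (scale_integral \<phi> z {0<..<\<eta>} (x - y) * \<bar>\<mu> y\<bar>) \<partial>lborel)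
      \<le> (\<integral>\<^sup>+ y. \<integral>\<^sup>+ t. ennreal (w y t * \<bar>\<mu> y\<bar>) \<partial>lborel \<partial>lborel)"
  proof (rule nn_integral_mono)
    fix y
    have "ennreal (LINT t|lborel. w y t) \<le> (\<integral>\<^sup>+ t. ennreal (w y t) \<partial>lborel)"
    proof (cases "integrable lborel (w y)")
      case True
      with w0 show ?thesis by (simp add: nn_integral_eq_integral)
    qed (simp add: not_integrable_integral_eq)
    moreover have "(\<integral>\<^sup>+ t. ennreal (w y t * \<bar>\<mu> y\<bar>) \<partial>lborel) = (\<integral>\<^sup>+ t. ennreal (w y t) \<partial>lborel) * ennreal \<bar>\<mu> y\<bar>"
      by (simp add: ennreal_mult w0 nn_integral_multc)
    moreover have "scale_integral \<phi> z {0<..<\<eta>} (x - y) = (LINT t|lborel. w y t)"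
      by (simp only: scale_integral_def set_lebesgue_integral_def w_def)
    ultimately show "ennreal (scale_integral \<phi> z {0<..<\<eta>} (x - y) * \<bar>\<mu> y\<bar>) \<le> (\<integral>\<^sup>+ t. ennreal (w y t * \<bar>\<mu> y\<bar>) \<partial>lborel)"
      by (simp add: ennreal_mult'' mult_right_mono)
  qed
  also have "\<dots> = (\<integral>\<^sup>+ t. \<integral>\<^sup>+ y. ennreal (w y t * \<bar>\<mu> y\<bar>) \<partial>lborel \<partial>lborel)"
    by (rule lborel_pair.Fubini') measurable
  also have "\<dots> \<le> (\<integral>\<^sup>+ t. ennreal (K * A * ?m) * ennreal (indicator {0<..\<eta>} t * t powr (?\<kappa> - s - 1)) \<partial>lborel)"
  proof (rule nn_integral_mono)
    fix t
    show "(\<integral>\<^sup>+ y. ennreal (w y t * \<bar>\<mu> y\<bar>) \<partial>lborel)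
        \<le> ennreal (K * A * ?m) * ennreal (indicator {0<..\<eta>} t * t powr (?\<kappa> - s - 1))"
    proof (cases "0 < t \<and> t < \<eta>")
      case True
      then have t: "0 < t" and ind: "indicator {0<..<\<eta>} t = (1::real)" "indicator {0<..\<eta>} t = (1::real)" by auto
      have zt: "0 \<le> z t" "z t \<le> K * t powr (real DIM('a) - s)" using z t by (auto simp: scale_weight_def)
      have "(\<integral>\<^sup>+ y. ennreal (w y t * \<bar>\<mu> y\<bar>) \<partial>lborel)
          = (\<integral>\<^sup>+ y. ennreal (z t / (t ^ DIM('a) * t)) * ennreal (\<phi> ((x - y) /\<^sub>R t) * \<bar>\<mu> y\<bar>) \<partial>lborel)"
        using t zt admissible_profile_nonneg[OF \<phi>]
        by (intro nn_integral_cong) (simp add: w_def ind scaled_def ennreal_mult[symmetric])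
      also have "\<dots> = ennreal (z t / (t ^ DIM('a) * t)) * (\<integral>\<^sup>+ y. ennreal (\<phi> ((x - y) /\<^sub>R t) * \<bar>\<mu> y\<bar>) \<partial>lborel)"
        using admissible_profile_measurable[OF \<phi>, measurable] by (intro nn_integral_cmult) measurable
      also have "\<dots> \<le> ennreal (K * t powr (real DIM('a) - s) / (t ^ DIM('a) * t)) * ennreal (A * t powr ?\<kappa> * ?m)"
        using zt t by (intro mult_mono A(2) ennreal_leI divide_right_mono) auto
      also have "\<dots> = ennreal ((K * A * ?m) * (t powr (real DIM('a) - s) * t powr ?\<kappa> / (t powr real DIM('a) * t)))"
        using t K A(1) Lp_norm_nonneg[of p \<mu>] by (simp add: ennreal_mult[symmetric] powr_realpow mult_ac)
      also have "t powr (real DIM('a) - s) * t powr ?\<kappa> / (t powr real DIM('a) * t) = t powr (?\<kappa> - s - 1)"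
      proof -
        have "t powr real DIM('a) * t = t powr (real DIM('a) + 1)"
          using t by (simp add: powr_add)
        then show ?thesis
          unfolding powr_add[symmetric] by (simp add: powr_diff[symmetric] algebra_simps)
      qed
      finally show ?thesis
        using K A(1) Lp_norm_nonneg[of p \<mu>] by (simp add: ind ennreal_mult)
    next
      case False
      then have "w y t = 0" for y by (auto simp: w_def indicator_def)
      then show ?thesis by simp
    qed
  qed
  also have "\<dots> = ennreal (K * A * ?m) * ennreal (\<eta> powr (?\<kappa> - s) / (?\<kappa> - s))"
    using p \<eta> nn_integral_powr_from_0[of "?\<kappa> - s - 1" \<eta>] by (simp add: nn_integral_cmult)
  also have "\<dots> = ennreal (K * A / (?\<kappa> - s) * ?m * \<eta> powr (?\<kappa> - s))"
    using p K A(1) Lp_norm_nonneg[of p \<mu>] by (simp add: ennreal_mult[symmetric])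
  finally show ?thesis .
qed

section \<open>The truncation of an admissible potential\<close>

lemma tendsto_set_integral_at_top:
  fixes f :: "real \<Rightarrow> real"
  assumes "set_integrable lborel {0<..} f"
  shows "((\<lambda>T. LINT t:{0<..T}|lborel. f t) \<longlongrightarrow> (LINT t:{0<..}|lborel. f t)) at_top"
proof -
  have lim: "((\<lambda>T. LINT t|lborel. indicator {..T} t *\<^sub>R (indicator {0<..} t *\<^sub>R f t))
      \<longlongrightarrow> (LINT t|lborel. indicator {0<..} t *\<^sub>R f t)) at_top"
    using assms unfolding set_integrable_def by (intro tendsto_integral_at_top) auto
  have eq: "indicator {..T} t *\<^sub>R (indicator {0<..} t *\<^sub>R f t) = indicator {0<..T} t *\<^sub>R f t" for T t
    by (auto simp: indicator_def)
  show ?thesis using lim unfolding eq set_lebesgue_integral_def .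
qed

lemma admissible_potential_scale_weight:
  fixes \<phi> :: "'a::euclidean_space \<Rightarrow> real"
  assumes "admissible_potential s \<phi> C\<^sub>\<zeta> \<zeta> \<rho> g"
  shows "scale_weight C\<^sub>\<zeta> (real DIM('a) - s) \<zeta>"
  using assms locally_integrable_pos_measurable
  unfolding admissible_potential_def scale_weight_def by blast

text \<open>
  The potential is a pointwise limit of scale integrals off the origin, and its value at the
  origin cannot affect measurability.
\<close>

lemma admissible_potential_measurable:
  fixes \<phi> g :: "'a::euclidean_space \<Rightarrow> real"
  assumes \<phi>: "admissible_profile s \<phi>" and g: "admissible_potential s \<phi> C\<^sub>\<zeta> \<zeta> \<rho> g"
  shows "g \<in> borel_measurable borel"
proof -
  define h where "h x = (if x = 0 then 0 else g x)" for x
  have [measurable]: "h \<in> borel_measurable borel"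
  proof (rule borel_measurable_LIMSEQ_real)
    let ?a = "\<lambda>n x. if x = 0 then 0
      else c_const s \<phi> * (scale_integral \<phi> \<zeta> {0<..real n} x - (if s = 0 then C_log \<phi> (real n) else 0))"
    have [measurable]: "scale_integral \<phi> \<zeta> {0<..real n} \<in> borel_measurable borel" for n
      using admissible_potential_scale_weight[OF g]
      by (intro scale_integral_measurable[OF \<phi>]) (auto simp: scale_weight_def)
    show "?a n \<in> borel_measurable borel" for n by measurable
    show "(\<lambda>n. ?a n x) \<longlonglongrightarrow> h x" for x
    proof (cases "x = 0")
      case False
      with g have "((\<lambda>T. c_const s \<phi> * (scale_integral \<phi> \<zeta> {0<..T} x - (if s = 0 then C_log \<phi> T else 0)))
          \<longlongrightarrow> g x) at_top"
        unfolding scale_integral_def admissible_potential_def by blast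
      from filterlim_compose[OF this filterlim_real_sequentially] False show ?thesis by (simp add: h_def)
    qed (simp add: h_def)
  qed
  have "(\<lambda>x. if x = 0 then g 0 else h x) \<in> borel_measurable borel"
    by measurable
  also have "(\<lambda>x. if x = 0 then g 0 else h x) = g" by (auto simp: h_def)
  finally show ?thesis .
qed

text \<open>
  The weight of the scales that truncation removes: for \<open>s = 0\<close> the perturbation \<open>\<rho>\<close> stays
  entirely in the truncated potential, so that only \<open>t ^ d\<close> is cut off.
\<close>

definition short_weight :: "real \<Rightarrow> nat \<Rightarrow> (real \<Rightarrow> real) \<Rightarrow> real \<Rightarrow> real" where
  "short_weight s d \<zeta> t = (if s = 0 then t ^ d else \<zeta> t)"

lemma scale_weight_short_weight:
  fixes \<phi> :: "'a::euclidean_space \<Rightarrow> real"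
  assumes "admissible_potential s \<phi> C\<^sub>\<zeta> \<zeta> \<rho> g"
  shows "scale_weight (if s = 0 then 1 else C\<^sub>\<zeta>) (real DIM('a) - s) (short_weight s DIM('a) \<zeta>)"
proof (cases "s = 0")
  case True
  have "scale_weight 1 (real DIM('a)) (\<lambda>t. t ^ DIM('a))"
    by (simp add: scale_weight_def powr_realpow)
  with True show ?thesis by (simp add: short_weight_def[abs_def])
next
  case False
  with admissible_potential_scale_weight[OF assms] show ?thesis
    by (simp add: short_weight_def[abs_def])
qed

lemma scale_integral_split:
  fixes \<phi> :: "'a::euclidean_space \<Rightarrow> real"
  assumes "set_integrable lborel {0<..<\<eta>} (\<lambda>t. z t * scaled \<phi> t x / t)"
    and "set_integrable lborel B (\<lambda>t. z t * scaled \<phi> t x / t)"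
    and "{0<..<\<eta>} \<inter> B = {}"
  shows "scale_integral \<phi> z ({0<..<\<eta>} \<union> B) x = scale_integral \<phi> z {0<..<\<eta>} x + scale_integral \<phi> z B x"
  unfolding scale_integral_def using assms(3,1,2) by (rule set_integral_Un)

lemma f_trunc_eq_positive:
  fixes \<phi> g :: "'a::euclidean_space \<Rightarrow> real"
  assumes \<phi>: "admissible_profile s \<phi>" and g: "admissible_potential s \<phi> C\<^sub>\<zeta> \<zeta> \<rho> g"
    and s: "0 < s" and \<eta>: "0 < \<eta>" and x: "x \<noteq> 0"
  shows "f_trunc s \<phi> \<zeta> \<rho> g \<eta> x = c_const s \<phi> * scale_integral \<phi> \<zeta> {0<..<\<eta>} x"
proof -
  let ?w = "\<lambda>t. \<zeta> t * scaled \<phi> t x / t"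
  note \<zeta> = admissible_potential_scale_weight[OF g]
  have near: "set_integrable lborel {0<..<\<eta>} ?w"
    using scale_integrable_near[OF \<phi> _ \<zeta> x, of \<eta>] s \<eta> by (auto elim!: set_integrable_subset)
  have far: "set_integrable lborel {\<eta>..} ?w"
    by (rule scale_integrable_far[OF \<phi> s \<zeta> \<eta>])
  have un: "{0<..} = {0<..<\<eta>} \<union> {\<eta>..}" using \<eta> by auto
  have "set_integrable lborel {0<..} ?w"
    unfolding un using near far by (rule set_integrable_Un) auto
  then have "((\<lambda>T. c_const s \<phi> * (LINT t:{0<..T}|lborel. ?w t)) \<longlongrightarrow> c_const s \<phi> * scale_integral \<phi> \<zeta> {0<..} x) at_top"
    unfolding scale_integral_def by (intro tendsto_intros tendsto_set_integral_at_top)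
  moreover have "((\<lambda>T. c_const s \<phi> * (LINT t:{0<..T}|lborel. ?w t)) \<longlongrightarrow> g x) at_top"
    using g s x unfolding admissible_potential_def by auto
  ultimately have "g x = c_const s \<phi> * scale_integral \<phi> \<zeta> {0<..} x"
    by (rule tendsto_unique[rotated, THEN sym]) simp
  also have "scale_integral \<phi> \<zeta> {0<..} x = scale_integral \<phi> \<zeta> {0<..<\<eta>} x + scale_integral \<phi> \<zeta> {\<eta>..} x"
    unfolding un by (intro scale_integral_split near far) auto
  finally show ?thesis
    using s by (simp add: f_trunc_def g_trunc_def scale_integral_def distrib_left)
qed

lemma rho_integrable:
  fixes \<phi> g :: "'a::euclidean_space \<Rightarrow> real"
  assumes \<phi>: "admissible_profile 0 \<phi>" and g: "admissible_potential 0 \<phi> C\<^sub>\<zeta> \<zeta> \<rho> g"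
  shows "set_integrable lborel {0<..} (\<lambda>t. \<rho> t * scaled \<phi> t x / t)"
proof -
  have \<rho>: "\<And>t. 0 < t \<Longrightarrow> 0 \<le> \<rho> t" "locally_integrable_pos \<rho>"
      "set_integrable lborel {0<..} (\<lambda>t. \<rho> t / t ^ DIM('a) / t)"
    using g by (auto simp: admissible_potential_def)
  have "set_integrable lborel {0<..} (\<lambda>t. \<phi> 0 * (\<rho> t / t ^ DIM('a) / t))"
    by (intro set_integrable_mult_right \<rho>(3))
  then show ?thesis
  proof (rule set_integrable_bound)
    show "set_borel_measurable lborel {0<..} (\<lambda>t. \<rho> t * scaled \<phi> t x / t)"
      using scale_integrand_measurable_section[OF \<phi> locally_integrable_pos_measurable[OF \<rho>(2)], of "{0<..}" x]
      by (simp add: set_borel_measurable_def)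
    have "norm (\<rho> t * scaled \<phi> t x / t) \<le> norm (\<phi> 0 * (\<rho> t / t ^ DIM('a) / t))" if t: "0 < t" for t
    proof -
      have "\<rho> t * scaled \<phi> t x / t \<le> \<rho> t * (\<phi> 0 / t ^ DIM('a)) / t"
        unfolding scaled_def using t \<rho>(1)[OF t] admissible_profile_le_0[OF \<phi>]
        by (intro divide_right_mono mult_left_mono) auto
      with t \<rho>(1)[OF t] admissible_profile_nonneg[OF \<phi>] show ?thesis
        by (simp add: scaled_def mult.commute)
    qed
    then show "AE t in lborel. t \<in> {0<..} \<longrightarrow> norm (\<rho> t * scaled \<phi> t x / t) \<le> norm (\<phi> 0 * (\<rho> t / t ^ DIM('a) / t))"
      by auto
  qed
qed

text \<open>
  For \<open>s = 0\<close> the large scales diverge logarithmically and converge only after renormalisation by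
  \<open>C_log\<close>.  The limit that defines \<open>g_trunc\<close> is not known to exist a priori: it is obtained from the
  one that defines \<open>g\<close> by subtracting the convergent contributions of the scales below \<open>\<eta>\<close> and
  of \<open>\<rho>\<close>.
\<close>

lemma f_trunc_eq_logarithmic:
  fixes \<phi> g :: "'a::euclidean_space \<Rightarrow> real"
  assumes \<phi>: "admissible_profile 0 \<phi>" and g: "admissible_potential 0 \<phi> C\<^sub>\<zeta> \<zeta> \<rho> g"
    and \<eta>: "0 < \<eta>" and x: "x \<noteq> 0"
  shows "f_trunc 0 \<phi> \<zeta> \<rho> g \<eta> x = c_const 0 \<phi> * scale_integral \<phi> (\<lambda>t. t ^ DIM('a)) {0<..<\<eta>} x"
proof -
  let ?z = "\<lambda>t::real. t ^ DIM('a)" and ?c = "c_const 0 \<phi>"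
  have z: "scale_weight 1 (real DIM('a) - 0) ?z"
    by (simp add: scale_weight_def powr_realpow)
  have c: "?c \<noteq> 0"
    using admissible_profile_0_pos[OF \<phi>] by (simp add: c_const_def profile_0[OF \<phi>])
  have z_int: "set_integrable lborel {0<..T} (\<lambda>t. ?z t * scaled \<phi> t x / t)" if "0 \<le> T" for T
    by (rule scale_integrable_near[OF \<phi> _ z x that]) simp
  note \<rho>_int = rho_integrable[OF \<phi> g, of x]
  let ?F = "\<lambda>T. scale_integral \<phi> ?z {\<eta>..T} x + scale_integral \<phi> \<rho> {0<..} x - C_log \<phi> T"
  have split: "(LINT t:{0<..T}|lborel. \<zeta> t * scaled \<phi> t x / t) - C_log \<phi> T
      = ?F T + scale_integral \<phi> ?z {0<..<\<eta>} x + (scale_integral \<phi> \<rho> {0<..T} x - scale_integral \<phi> \<rho> {0<..} x)"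
    if T: "\<eta> \<le> T" for T
  proof -
    have "(LINT t:{0<..T}|lborel. \<zeta> t * scaled \<phi> t x / t)
        = (LINT t:{0<..T}|lborel. ?z t * scaled \<phi> t x / t + \<rho> t * scaled \<phi> t x / t)"
      using g by (intro set_lebesgue_integral_cong)
        (auto simp: admissible_potential_def add_divide_distrib distrib_right)
    also have "\<dots> = scale_integral \<phi> ?z {0<..T} x + scale_integral \<phi> \<rho> {0<..T} x"
      unfolding scale_integral_def using T \<eta> \<rho>_int
      by (intro set_integral_add z_int) (auto elim!: set_integrable_subset)
    also have "{0<..T} = {0<..<\<eta>} \<union> {\<eta>..T}" using T \<eta> by auto
    also have "scale_integral \<phi> ?z ({0<..<\<eta>} \<union> {\<eta>..T}) x
        = scale_integral \<phi> ?z {0<..<\<eta>} x + scale_integral \<phi> ?z {\<eta>..T} x"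
    proof (rule scale_integral_split)
      show "set_integrable lborel {0<..<\<eta>} (\<lambda>t. ?z t * scaled \<phi> t x / t)"
        by (rule set_integrable_subset[OF z_int[of \<eta>]]) (use \<eta> in auto)
      show "set_integrable lborel {\<eta>..T} (\<lambda>t. ?z t * scaled \<phi> t x / t)"
        by (rule set_integrable_subset[OF z_int[of T]]) (use T \<eta> in auto)
    qed auto
    finally show ?thesis using T \<eta> by (simp add: ivl_disj_un)
  qed
  have "((\<lambda>T. ?c * ((LINT t:{0<..T}|lborel. \<zeta> t * scaled \<phi> t x / t) - C_log \<phi> T)) \<longlongrightarrow> g x) at_top"
    using g x by (auto simp: admissible_potential_def)
  moreover have "eventually (\<lambda>T. ?c * ((LINT t:{0<..T}|lborel. \<zeta> t * scaled \<phi> t x / t) - C_log \<phi> T)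
      = ?c * (?F T + scale_integral \<phi> ?z {0<..<\<eta>} x + (scale_integral \<phi> \<rho> {0<..T} x - scale_integral \<phi> \<rho> {0<..} x))) at_top"
    using eventually_ge_at_top[of \<eta>] by eventually_elim (simp only: split)
  ultimately have "((\<lambda>T. ?c * (?F T + scale_integral \<phi> ?z {0<..<\<eta>} x
      + (scale_integral \<phi> \<rho> {0<..T} x - scale_integral \<phi> \<rho> {0<..} x))) \<longlongrightarrow> g x) at_top"
    by (rule Lim_transform_eventually)
  from tendsto_divide[OF this tendsto_const[of ?c] c]
  have 1: "((\<lambda>T. ?F T + scale_integral \<phi> ?z {0<..<\<eta>} x
      + (scale_integral \<phi> \<rho> {0<..T} x - scale_integral \<phi> \<rho> {0<..} x)) \<longlongrightarrow> g x / ?c) at_top"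
    using c by simp
  have 2: "((\<lambda>T. scale_integral \<phi> \<rho> {0<..T} x) \<longlongrightarrow> scale_integral \<phi> \<rho> {0<..} x) at_top"
    unfolding scale_integral_def by (rule tendsto_set_integral_at_top[OF \<rho>_int])
  have 3: "((\<lambda>T. (?F T + scale_integral \<phi> ?z {0<..<\<eta>} x
      + (scale_integral \<phi> \<rho> {0<..T} x - scale_integral \<phi> \<rho> {0<..} x))
      - scale_integral \<phi> ?z {0<..<\<eta>} x - (scale_integral \<phi> \<rho> {0<..T} x - scale_integral \<phi> \<rho> {0<..} x))
      \<longlongrightarrow> g x / ?c - scale_integral \<phi> ?z {0<..<\<eta>} x
        - (scale_integral \<phi> \<rho> {0<..} x - scale_integral \<phi> \<rho> {0<..} x)) at_top"
    by (intro tendsto_diff 1 2 tendsto_const)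
  have cancel: "a + b + e - b - e = a" for a b e :: real by simp
  have "(?F \<longlongrightarrow> g x / ?c - scale_integral \<phi> ?z {0<..<\<eta>} x) at_top"
    using 3 unfolding cancel diff_self diff_zero .
  then have "Lim at_top ?F = g x / ?c - scale_integral \<phi> ?z {0<..<\<eta>} x"
    by (rule tendsto_Lim[rotated]) simp
  then have "g_trunc 0 \<phi> \<zeta> \<rho> \<eta> x = g x - ?c * scale_integral \<phi> ?z {0<..<\<eta>} x"
    using c by (simp add: g_trunc_def scale_integral_def right_diff_distrib)
  then show ?thesis by (simp add: f_trunc_def)
qed

text \<open>
  Consequently \<open>f_trunc\<close> is nonnegative and even off the origin, and has the same form for all
  \<open>s\<close>.  At the origin its value is arbitrary.
\<close>

lemma f_trunc_eq:
  fixes \<phi> g :: "'a::euclidean_space \<Rightarrow> real"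
  assumes "admissible_profile s \<phi>" "admissible_potential s \<phi> C\<^sub>\<zeta> \<zeta> \<rho> g" "0 \<le> s" "0 < \<eta>" "x \<noteq> 0"
  shows "f_trunc s \<phi> \<zeta> \<rho> g \<eta> x = c_const s \<phi> * scale_integral \<phi> (short_weight s DIM('a) \<zeta>) {0<..<\<eta>} x"
  using assms f_trunc_eq_positive[of s \<phi> C\<^sub>\<zeta> \<zeta> \<rho> g \<eta> x] f_trunc_eq_logarithmic[of \<phi> C\<^sub>\<zeta> \<zeta> \<rho> g \<eta> x]
  by (cases "s = 0") (auto simp: short_weight_def[abs_def])

text \<open>
  At the origin every \<open>\<phi>\<^sub>t\<close> equals \<open>\<phi> 0 / t ^ d\<close>, the truncated integral is \<open>\<phi> 0 * (ln T - ln \<eta>)\<close>, and the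
  \<open>ln T\<close> cancels against \<open>C_log\<close> exactly.
\<close>

lemma g_trunc_origin_logarithmic:
  fixes \<phi> g :: "'a::euclidean_space \<Rightarrow> real"
  assumes \<phi>: "admissible_profile 0 \<phi>" and \<eta>: "0 < \<eta>"
  shows "g_trunc 0 \<phi> \<zeta> \<rho> \<eta> 0 = - ln \<eta> + (LINT t:{0<..}|lborel. \<rho> t / t ^ DIM('a) / t)
    + (LINT r:{0<..}|lborel. ln r * deriv (profile \<phi>) r) / \<phi> 0"
proof -
  let ?R = "LINT t:{0<..}|lborel. \<rho> t / t ^ DIM('a) / t"
  let ?K = "LINT r:{0<..}|lborel. ln r * deriv (profile \<phi>) r"
  have \<phi>0: "0 < \<phi> 0" by (rule admissible_profile_0_pos[OF \<phi>])
  have far: "(LINT t:{\<eta>..T}|lborel. t ^ DIM('a) * scaled \<phi> t (0::'a) / t) = \<phi> 0 * (ln T - ln \<eta>)"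
    if T: "\<eta> \<le> T" for T
  proof -
    have "(LINT t:{\<eta>..T}|lborel. t ^ DIM('a) * scaled \<phi> t (0::'a) / t) = (LINT t:{\<eta>..T}|lborel. \<phi> 0 * inverse t)"
      using \<eta> by (intro set_lebesgue_integral_cong) (auto simp: scaled_def field_simps)
    also have "\<dots> = \<phi> 0 * (LINT t|lborel. indicator {\<eta>..T} t *\<^sub>R inverse t)"
      unfolding set_integral_mult_right unfolding set_lebesgue_integral_def ..
    also have "(LINT t|lborel. indicator {\<eta>..T} t *\<^sub>R inverse t) = ln T - ln \<eta>"
      using \<eta> T by (intro integral_FTC_Icc)
        (auto intro!: continuous_intros derivative_eq_intros simp: has_real_derivative_iff_has_vector_derivative[symmetric] divide_inverse)
    finally show ?thesis .
  qed
  have rho: "(LINT t:{0<..}|lborel. \<rho> t * scaled \<phi> t (0::'a) / t) = \<phi> 0 * ?R"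
    unfolding set_integral_mult_right[symmetric]
    by (intro set_lebesgue_integral_cong) (auto simp: scaled_def)
  let ?F = "\<lambda>T. (LINT t:{\<eta>..T}|lborel. t ^ DIM('a) * scaled \<phi> t (0::'a) / t)
      + (LINT t:{0<..}|lborel. \<rho> t * scaled \<phi> t (0::'a) / t) - C_log \<phi> T"
  have "eventually (\<lambda>T. ?F T = - \<phi> 0 * ln \<eta> + \<phi> 0 * ?R + ?K) at_top"
    using eventually_ge_at_top[of \<eta>]
    by eventually_elim (simp only: far rho, simp add: C_log_def profile_0[OF \<phi>] algebra_simps)
  then have "(?F \<longlongrightarrow> - \<phi> 0 * ln \<eta> + \<phi> 0 * ?R + ?K) at_top"
    by (rule tendsto_eventually)
  then have "Lim at_top ?F = - \<phi> 0 * ln \<eta> + \<phi> 0 * ?R + ?K"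
    by (rule tendsto_Lim[rotated]) simp
  then have "g_trunc 0 \<phi> \<zeta> \<rho> \<eta> 0 = inverse (\<phi> 0) * (- \<phi> 0 * ln \<eta> + \<phi> 0 * ?R + ?K)"
    by (simp add: g_trunc_def c_const_def profile_0[OF \<phi>])
  then show ?thesis
    using \<phi>0 by (simp add: field_simps)
qed

lemma g_trunc_positive_bounds:
  fixes \<phi> g :: "'a::euclidean_space \<Rightarrow> real"
  assumes \<phi>: "admissible_profile s \<phi>" and g: "admissible_potential s \<phi> C\<^sub>\<zeta> \<zeta> \<rho> g"
    and s: "0 < s" and \<eta>: "0 < \<eta>"
  shows "0 \<le> g_trunc s \<phi> \<zeta> \<rho> \<eta> x"
    and "g_trunc s \<phi> \<zeta> \<rho> \<eta> x \<le> c_const s \<phi> * \<phi> 0 * C\<^sub>\<zeta> * g_Riesz s \<eta>"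
proof -
  note \<zeta> = admissible_potential_scale_weight[OF g]
  have c: "0 \<le> c_const s \<phi>" using \<phi> s by (intro c_const_nonneg) auto
  have eq: "g_trunc s \<phi> \<zeta> \<rho> \<eta> x = c_const s \<phi> * scale_integral \<phi> \<zeta> {\<eta>..} x"
    using s by (simp add: g_trunc_def scale_integral_def)
  have "0 \<le> scale_integral \<phi> \<zeta> {\<eta>..} x"
    using \<eta> by (intro scale_integral_nonneg[OF \<phi> \<zeta>]) auto
  with c show "0 \<le> g_trunc s \<phi> \<zeta> \<rho> \<eta> x" unfolding eq by simp
  have "g_trunc s \<phi> \<zeta> \<rho> \<eta> x \<le> c_const s \<phi> * (C\<^sub>\<zeta> * \<phi> 0 * (\<eta> powr (- s) / s))"
    unfolding eq by (intro mult_left_mono c scale_integral_far_le[OF \<phi> s \<zeta> \<eta>])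
  then show "g_trunc s \<phi> \<zeta> \<rho> \<eta> x \<le> c_const s \<phi> * \<phi> 0 * C\<^sub>\<zeta> * g_Riesz s \<eta>"
    using s \<eta> by (simp add: g_Riesz_def mult_ac)
qed

lemma g_trunc_measurable:
  fixes \<phi> g :: "'a::euclidean_space \<Rightarrow> real"
  assumes \<phi>: "admissible_profile s \<phi>" and g: "admissible_potential s \<phi> C\<^sub>\<zeta> \<zeta> \<rho> g"
    and s: "0 \<le> s" and \<eta>: "0 < \<eta>"
  shows "g_trunc s \<phi> \<zeta> \<rho> \<eta> \<in> borel_measurable borel"
proof -
  let ?S = "scale_integral \<phi> (short_weight s DIM('a) \<zeta>) {0<..<\<eta>}"
  have [measurable]: "?S \<in> borel_measurable borel"
    using scale_weight_short_weight[OF g]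
    by (intro scale_integral_measurable[OF \<phi>]) (auto simp: scale_weight_def)
  have [measurable]: "g \<in> borel_measurable borel"
    by (rule admissible_potential_measurable[OF \<phi> g])
  have "(\<lambda>x. if x = 0 then g_trunc s \<phi> \<zeta> \<rho> \<eta> 0 else g x - c_const s \<phi> * ?S x) \<in> borel_measurable borel"
    by measurable
  also have "(\<lambda>x. if x = 0 then g_trunc s \<phi> \<zeta> \<rho> \<eta> 0 else g x - c_const s \<phi> * ?S x) = g_trunc s \<phi> \<zeta> \<rho> \<eta>"
  proof
    show "(if x = 0 then g_trunc s \<phi> \<zeta> \<rho> \<eta> 0 else g x - c_const s \<phi> * ?S x) = g_trunc s \<phi> \<zeta> \<rho> \<eta> x" for x
      using f_trunc_eq[OF \<phi> g s \<eta>, of x] by (auto simp: f_trunc_def)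
  qed
  finally show ?thesis .
qed

lemma integrable_tensor_square:
  fixes \<mu> :: "'a::euclidean_space \<Rightarrow> real"
  assumes \<mu>: "integrable lborel \<mu>"
  shows "integrable (lborel \<Otimes>\<^sub>M lborel) (\<lambda>(x, y). \<mu> x * \<mu> y)"
proof (rule lborel_pair.Fubini_integrable)
  have [measurable]: "\<mu> \<in> borel_measurable borel" using \<mu> by auto
  show "(\<lambda>(x, y). \<mu> x * \<mu> y) \<in> borel_measurable (lborel \<Otimes>\<^sub>M lborel)" by measurable
qed (use \<mu> in \<open>auto simp: abs_mult\<close>)

section \<open>The truncated modulated energy\<close>

theorem proposition2p11:
  shows "\<exists>C\<^sub>\<rho> :: (real \<Rightarrow> real) \<Rightarrow> real.
    (\<forall>\<rho>. 0 \<le> C\<^sub>\<rho> \<rho>) \<and> (\<forall>\<rho>. (\<forall>t>0. \<rho> t = 0) \<longrightarrow> C\<^sub>\<rho> \<rho> = 0) \<and>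
    (\<forall>(s::real) (p::ereal) (\<phi> :: 'a::euclidean_space \<Rightarrow> real).
      0 \<le> s \<and> s < real DIM('a) \<and> ereal (real DIM('a) / (real DIM('a) - s)) < p \<and>
      admissible_profile s \<phi> \<longrightarrow>
      (\<exists>C>0. \<forall>(C\<^sub>\<zeta>::real) (\<zeta>::real \<Rightarrow> real) (\<rho>::real \<Rightarrow> real) (g::'a \<Rightarrow> real) (\<mu>::'a \<Rightarrow> real)
          (N::nat) (X::nat \<Rightarrow> 'a) (\<eta>::real).
        admissible_potential s \<phi> C\<^sub>\<zeta> \<zeta> \<rho> g \<and>
        integrable lborel \<mu> \<and> in_Lp p \<mu> \<and> (LINT x|lborel. \<mu> x) = 1 \<and>
        \<comment> \<open>\<open>ennreal\<close> truncates negative values: the integral of the positive part is finite\<close>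
        (\<integral>\<^sup>+ (x, y). ennreal (g (x - y) * (\<mu> x * \<mu> y)) \<partial>(lborel \<Otimes>\<^sub>M lborel)) < \<infinity> \<and>
        (s = 0 \<longrightarrow>
          (\<integral>\<^sup>+ (x, y). ennreal (\<bar>g (x - y)\<bar> * (\<bar>\<mu> x\<bar> * \<bar>\<mu> y\<bar>)) \<partial>(lborel \<Otimes>\<^sub>M lborel)) < \<infinity>) \<and>
        1 \<le> N \<and> inj_on X {1..N} \<and> 0 < \<eta> \<longrightarrow>
        1 / (2 * (real N)\<^sup>2) *
            (\<Sum>i\<in>{1..N}. \<Sum>j\<in>{1..N} - {i}. f_trunc s \<phi> \<zeta> \<rho> g \<eta> (X i - X j))
          + 1 / 2 * (LINT (x, y)|(lborel \<Otimes>\<^sub>M lborel). f_trunc s \<phi> \<zeta> \<rho> g \<eta> (x - y) * (\<mu> x * \<mu> y))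
          + 1 / 2 * diff_square_integral (empirical_measure N X) \<mu> UNIV
              (\<lambda>(x, y). g_trunc s \<phi> \<zeta> \<rho> \<eta> (x - y))
        \<le> modulated_energy g N X \<mu>
          + (if s = 0 then (g_Riesz s \<eta> + C + C\<^sub>\<rho> \<rho>) / (2 * real N) else 0)
          + (if s > 0 then C * C\<^sub>\<zeta> * (g_Riesz s \<eta> / (2 * real N)) else 0)
          + C * (if s = 0 then 1 else C\<^sub>\<zeta>) * Lp_norm p \<mu>
              * \<eta> powr (real DIM('a) * inv_conj_exponent p - s)))"
proof -
  define C\<^sub>\<rho> :: "(real \<Rightarrow> real) \<Rightarrow> real" where
    "C\<^sub>\<rho> \<rho> = \<bar>LINT t:{0<..}|lborel. \<rho> t / t ^ DIM('a) / t\<bar>" for \<rho>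
  show ?thesis
  proof (intro exI[of _ C\<^sub>\<rho>] conjI allI impI)
    show "0 \<le> C\<^sub>\<rho> \<rho>" for \<rho> by (simp add: C\<^sub>\<rho>_def)
    show "C\<^sub>\<rho> \<rho> = 0" if "\<forall>t>0. \<rho> t = 0" for \<rho>
    proof -
      have zero: "indicator {0<..} t *\<^sub>R (\<rho> t / t ^ DIM('a) / t) = 0" for t
        using that by (auto simp: indicator_def)
      then show ?thesis unfolding C\<^sub>\<rho>_def set_lebesgue_integral_def zero by simp
    qed
  next
    fix s :: real and p :: ereal and \<phi> :: "'a \<Rightarrow> real"
    assume "0 \<le> s \<and> s < real DIM('a) \<and> ereal (real DIM('a) / (real DIM('a) - s)) < p \<and> admissible_profile s \<phi>"
    then have s: "0 \<le> s" "s < real DIM('a)" and p: "ereal (real DIM('a) / (real DIM('a) - s)) < p"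
      and \<phi>: "admissible_profile s \<phi>" by auto
    note p1 = inv_conj_exponent_gt(1)[OF s p] and ps = inv_conj_exponent_gt(2)[OF s p]
    let ?\<kappa> = "real DIM('a) * inv_conj_exponent p" and ?c = "c_const s \<phi>"
    obtain A where A: "0 \<le> A" "\<And>\<mu> t x. in_Lp p \<mu> \<Longrightarrow> 0 < t \<Longrightarrow>
      (\<integral>\<^sup>+ y. ennreal (\<phi> ((x - y) /\<^sub>R t) * \<bar>\<mu> y\<bar>) \<partial>lborel)
        \<le> ennreal (A * t powr ?\<kappa> * Lp_norm p \<mu>)"
      by (rule convolution_profile_le_Lp_norm[OF \<phi> p1]) blast
    define K where "K = (LINT r:{0<..}|lborel. ln r * deriv (profile \<phi>) r) / \<phi> 0"
    \<comment> \<open>One summand for each error term: the diagonal if \<open>s > 0\<close>, the diagonal if \<open>s = 0\<close>, and the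
        mixed terms; the \<open>1\<close> makes the sum positive.\<close>
    define C where "C = 1 + ?c * \<phi> 0 + \<bar>K\<bar> + ?c * A / (?\<kappa> - s)"
    have c: "0 \<le> ?c" by (rule c_const_nonneg[OF \<phi> s(1)])
    have parts: "0 \<le> ?c * \<phi> 0" "0 \<le> \<bar>K\<bar>" "0 \<le> ?c * A / (?\<kappa> - s)"
      using c A(1) ps admissible_profile_nonneg[OF \<phi>] by auto
    then have C: "0 < C" "?c * \<phi> 0 \<le> C" "K \<le> C" "?c * A / (?\<kappa> - s) \<le> C"
      unfolding C_def by linarith+
    show "\<exists>C>0. \<forall>(C\<^sub>\<zeta>::real) (\<zeta>::real \<Rightarrow> real) (\<rho>::real \<Rightarrow> real) (g::'a \<Rightarrow> real) (\<mu>::'a \<Rightarrow> real)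
          (N::nat) (X::nat \<Rightarrow> 'a) (\<eta>::real).
        admissible_potential s \<phi> C\<^sub>\<zeta> \<zeta> \<rho> g \<and>
        integrable lborel \<mu> \<and> in_Lp p \<mu> \<and> (LINT x|lborel. \<mu> x) = 1 \<and>
        (\<integral>\<^sup>+ (x, y). ennreal (g (x - y) * (\<mu> x * \<mu> y)) \<partial>(lborel \<Otimes>\<^sub>M lborel)) < \<infinity> \<and>
        (s = 0 \<longrightarrow>
          (\<integral>\<^sup>+ (x, y). ennreal (\<bar>g (x - y)\<bar> * (\<bar>\<mu> x\<bar> * \<bar>\<mu> y\<bar>)) \<partial>(lborel \<Otimes>\<^sub>M lborel)) < \<infinity>) \<and>
        1 \<le> N \<and> inj_on X {1..N} \<and> 0 < \<eta> \<longrightarrow>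
        1 / (2 * (real N)\<^sup>2) *
            (\<Sum>i\<in>{1..N}. \<Sum>j\<in>{1..N} - {i}. f_trunc s \<phi> \<zeta> \<rho> g \<eta> (X i - X j))
          + 1 / 2 * (LINT (x, y)|(lborel \<Otimes>\<^sub>M lborel). f_trunc s \<phi> \<zeta> \<rho> g \<eta> (x - y) * (\<mu> x * \<mu> y))
          + 1 / 2 * diff_square_integral (empirical_measure N X) \<mu> UNIV
              (\<lambda>(x, y). g_trunc s \<phi> \<zeta> \<rho> \<eta> (x - y))
        \<le> modulated_energy g N X \<mu>
          + (if s = 0 then (g_Riesz s \<eta> + C + C\<^sub>\<rho> \<rho>) / (2 * real N) else 0)
          + (if s > 0 then C * C\<^sub>\<zeta> * (g_Riesz s \<eta> / (2 * real N)) else 0)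
          + C * (if s = 0 then 1 else C\<^sub>\<zeta>) * Lp_norm p \<mu>
              * \<eta> powr (?\<kappa> - s)"
    proof (intro exI[of _ C] conjI allI impI, fact C(1), elim conjE)
      fix C\<^sub>\<zeta> \<eta> :: real and \<zeta> \<rho> :: "real \<Rightarrow> real" and g \<mu> :: "'a \<Rightarrow> real" and N :: nat and X :: "nat \<Rightarrow> 'a"
      assume g: "admissible_potential s \<phi> C\<^sub>\<zeta> \<zeta> \<rho> g" and \<mu>: "integrable lborel \<mu>" and \<mu>p: "in_Lp p \<mu>"
        and log: "s = 0 \<longrightarrow>
          (\<integral>\<^sup>+ (x, y). ennreal (\<bar>g (x - y)\<bar> * (\<bar>\<mu> x\<bar> * \<bar>\<mu> y\<bar>)) \<partial>(lborel \<Otimes>\<^sub>M lborel)) < \<infinity>"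
        and N: "1 \<le> N" and X: "inj_on X {1..N}" and \<eta>: "0 < \<eta>"
      let ?g\<eta> = "g_trunc s \<phi> \<zeta> \<rho> \<eta>" and ?K = "if s = 0 then 1 else C\<^sub>\<zeta>"
      let ?S = "scale_integral \<phi> (short_weight s DIM('a) \<zeta>) {0<..<\<eta>}"
      let ?E = "Lp_norm p \<mu> * \<eta> powr (?\<kappa> - s)"
      define B where "B = ?c * (?K * A / (?\<kappa> - s) * Lp_norm p \<mu> * \<eta> powr (?\<kappa> - s))"
      note z = scale_weight_short_weight[OF g]
      have K0: "0 \<le> ?K" by (rule scale_weight_const_nonneg[OF z])
      have E0: "0 \<le> ?E" by (simp add: Lp_norm_nonneg)
      have B0: "0 \<le> B" using c K0 A(1) ps by (simp add: B_def Lp_norm_nonneg)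
      have [measurable]: "\<mu> \<in> borel_measurable borel" "g \<in> borel_measurable borel" "?g\<eta> \<in> borel_measurable borel"
        using \<mu> admissible_potential_measurable[OF \<phi> g] g_trunc_measurable[OF \<phi> g s(1) \<eta>] by auto
      have [measurable]: "?S \<in> borel_measurable borel"
        using z by (intro scale_integral_measurable[OF \<phi>]) (auto simp: scale_weight_def)
      have diff: "\<bar>g x - ?g\<eta> x\<bar> = ?c * ?S x" if "x \<noteq> 0" for x
      proof -
        have "g x - ?g\<eta> x = ?c * ?S x"
          using f_trunc_eq[OF \<phi> g s(1) \<eta> that] by (simp add: f_trunc_def)
        moreover have "0 \<le> ?S x" by (rule scale_integral_nonneg[OF \<phi> z]) auto
        ultimately show ?thesis using c by simp
      qed
      have short: "(\<integral>\<^sup>+ y. ennreal (?c * ?S (x - y) * \<bar>\<mu> y\<bar>) \<partial>lborel) \<le> ennreal B" for x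
      proof -
        have "(\<integral>\<^sup>+ y. ennreal (?c * ?S (x - y) * \<bar>\<mu> y\<bar>) \<partial>lborel)
            = (\<integral>\<^sup>+ y. ennreal ?c * ennreal (?S (x - y) * \<bar>\<mu> y\<bar>) \<partial>lborel)"
          using c by (simp add: ennreal_mult' mult.assoc)
        also have "\<dots> = ennreal ?c * (\<integral>\<^sup>+ y. ennreal (?S (x - y) * \<bar>\<mu> y\<bar>) \<partial>lborel)"
          by (rule nn_integral_cmult) measurable
        also have "\<dots> \<le> ennreal ?c * ennreal (?K * A / (?\<kappa> - s) * Lp_norm p \<mu> * \<eta> powr (?\<kappa> - s))"
          by (intro mult_left_mono short_range_potential_bound[OF \<phi> s(1) ps A(1) _ _ z \<eta>] A(2) \<mu>p) auto
        also have "\<dots> = ennreal B"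
          unfolding B_def by (rule ennreal_mult'[OF c, symmetric])
        finally show ?thesis .
      qed
      have "1 / (2 * (real N)\<^sup>2) * (\<Sum>i\<in>{1..N}. \<Sum>j\<in>{1..N} - {i}. g (X i - X j) - ?g\<eta> (X i - X j))
          + 1 / 2 * (LINT (x, y)|(lborel \<Otimes>\<^sub>M lborel). (g (x - y) - ?g\<eta> (x - y)) * (\<mu> x * \<mu> y))
          + 1 / 2 * diff_square_integral (empirical_measure N X) \<mu> UNIV (\<lambda>(x, y). ?g\<eta> (x - y))
        \<le> modulated_energy g N X \<mu> + ?g\<eta> 0 / (2 * real N) + B"
      proof (rule energy_splitting)
        fix x
        have "(\<integral>\<^sup>+ y. ennreal (\<bar>g (x - y) - ?g\<eta> (x - y)\<bar> * \<bar>\<mu> y\<bar>) \<partial>lborel)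
            = (\<integral>\<^sup>+ y. ennreal (?c * ?S (x - y) * \<bar>\<mu> y\<bar>) \<partial>lborel)"
          by (intro nn_integral_cong_AE eventually_mono[OF AE_lborel_singleton[of x]]) (simp add: diff)
        then show "(\<integral>\<^sup>+ y. ennreal (\<bar>g (x - y) - ?g\<eta> (x - y)\<bar> * \<bar>\<mu> y\<bar>) \<partial>lborel) \<le> ennreal B"
          using short by simp
      next
        fix y
        have "?S (x - y) = ?S (y - x)" for x
          using scale_integral_even[OF \<phi>, of "short_weight s DIM('a) \<zeta>" "{0<..<\<eta>}" "y - x"] by simp
        then have "(\<integral>\<^sup>+ x. ennreal (\<bar>g (x - y) - ?g\<eta> (x - y)\<bar> * \<bar>\<mu> x\<bar>) \<partial>lborel)
            = (\<integral>\<^sup>+ x. ennreal (?c * ?S (y - x) * \<bar>\<mu> x\<bar>) \<partial>lborel)"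
          by (intro nn_integral_cong_AE eventually_mono[OF AE_lborel_singleton[of y]]) (simp add: diff)
        then show "(\<integral>\<^sup>+ x. ennreal (\<bar>g (x - y) - ?g\<eta> (x - y)\<bar> * \<bar>\<mu> x\<bar>) \<partial>lborel) \<le> ennreal B"
          using short by simp
      next
        show "integrable (lborel \<Otimes>\<^sub>M lborel) (\<lambda>(x, y). ?g\<eta> (x - y) * (\<mu> x * \<mu> y)) \<or>
          integrable (lborel \<Otimes>\<^sub>M lborel) (\<lambda>(x, y). g (x - y) * (\<mu> x * \<mu> y))"
        \<comment> \<open>For \<open>s > 0\<close> the truncated kernel is bounded; for \<open>s = 0\<close> it is not, and the finite
            logarithmic energy of \<open>\<mu>\<close> is used instead.\<close>
        proof (cases "s = 0")
          case True
          have "integrable (lborel \<Otimes>\<^sub>M lborel) (\<lambda>(x, y). g (x - y) * (\<mu> x * \<mu> y))"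
            using log True by (intro integrableI_bounded) (auto simp: abs_mult split_beta')
          then show ?thesis ..
        next
          case False
          with s(1) have s0: "0 < s" by simp
          let ?M = "?c * \<phi> 0 * C\<^sub>\<zeta> * g_Riesz s \<eta>"
          have "\<bar>?g\<eta> x\<bar> \<le> ?M" for x
            using g_trunc_positive_bounds[OF \<phi> g s0 \<eta>, of x] by simp
          then have le: "\<bar>?g\<eta> x\<bar> \<le> \<bar>?M\<bar>" for x
            by (rule order_trans[OF _ abs_ge_self])
          have "\<bar>?g\<eta> (x - y) * (\<mu> x * \<mu> y)\<bar> \<le> \<bar>?M * (\<mu> x * \<mu> y)\<bar>" for x y
            unfolding abs_mult[of _ "\<mu> x * \<mu> y"] by (rule mult_right_mono[OF le]) simp
          then have "integrable (lborel \<Otimes>\<^sub>M lborel) (\<lambda>(x, y). ?g\<eta> (x - y) * (\<mu> x * \<mu> y))"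
            by (intro Bochner_Integration.integrable_bound[OF integrable_mult_right[OF integrable_tensor_square[OF \<mu>], of ?M]])
              (auto simp: split_beta')
          then show ?thesis ..
        qed
      qed (use \<mu> N X B0 in auto)
      moreover have "B \<le> C * ?K * Lp_norm p \<mu> * \<eta> powr (?\<kappa> - s)"
      proof -
        have "B = ?c * A / (?\<kappa> - s) * (?K * ?E)" by (simp add: B_def)
        also have "\<dots> \<le> C * (?K * ?E)"
          by (intro mult_right_mono C mult_nonneg_nonneg K0 E0)
        finally show ?thesis by (simp add: mult.assoc)
      qed
      moreover have "?g\<eta> 0 / (2 * real N) \<le> (if s = 0 then (g_Riesz s \<eta> + C + C\<^sub>\<rho> \<rho>) / (2 * real N) else 0)
          + (if s > 0 then C * C\<^sub>\<zeta> * (g_Riesz s \<eta> / (2 * real N)) else 0)"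
      proof (cases "s = 0")
        case True
        have "?g\<eta> 0 = - ln \<eta> + (LINT t:{0<..}|lborel. \<rho> t / t ^ DIM('a) / t) + K"
          using g_trunc_origin_logarithmic[of \<phi> \<eta> \<zeta> \<rho>] \<phi> \<eta> True by (simp add: K_def)
        also have "\<dots> \<le> g_Riesz s \<eta> + C + C\<^sub>\<rho> \<rho>"
          using C(3) True \<eta> by (simp add: g_Riesz_def C\<^sub>\<rho>_def)
        finally show ?thesis
          using True N by (simp add: divide_right_mono)
      next
        case False
        with s(1) have s0: "0 < s" by simp
        have "?g\<eta> 0 \<le> ?c * \<phi> 0 * (C\<^sub>\<zeta> * g_Riesz s \<eta>)"
          using g_trunc_positive_bounds(2)[OF \<phi> g s0 \<eta>, of 0] by (simp add: mult.assoc)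
        also have "\<dots> \<le> C * (C\<^sub>\<zeta> * g_Riesz s \<eta>)"
          using K0 s0 False by (intro mult_right_mono C(2)) (auto simp: g_Riesz_def)
        finally have "?g\<eta> 0 / (2 * real N) \<le> C * (C\<^sub>\<zeta> * g_Riesz s \<eta>) / (2 * real N)"
          by (rule divide_right_mono) simp
        then show ?thesis using s0 by (simp add: mult.assoc)
      qed
      ultimately show "1 / (2 * (real N)\<^sup>2) *
            (\<Sum>i\<in>{1..N}. \<Sum>j\<in>{1..N} - {i}. f_trunc s \<phi> \<zeta> \<rho> g \<eta> (X i - X j))
          + 1 / 2 * (LINT (x, y)|(lborel \<Otimes>\<^sub>M lborel). f_trunc s \<phi> \<zeta> \<rho> g \<eta> (x - y) * (\<mu> x * \<mu> y))
          + 1 / 2 * diff_square_integral (empirical_measure N X) \<mu> UNIV (\<lambda>(x, y). ?g\<eta> (x - y))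
        \<le> modulated_energy g N X \<mu>
          + (if s = 0 then (g_Riesz s \<eta> + C + C\<^sub>\<rho> \<rho>) / (2 * real N) else 0)
          + (if s > 0 then C * C\<^sub>\<zeta> * (g_Riesz s \<eta> / (2 * real N)) else 0)
          + C * ?K * Lp_norm p \<mu> * \<eta> powr (?\<kappa> - s)"
        unfolding f_trunc_def by linarith
    qed
  qed
qed

end
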